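(* Let $1<p<\infty$ and let $W:\mathbb{R}^d\to\mathcal{M}_n(\mathbb{C})$ be a matrix $A_p$ weight. Then there exist dyadic grids $\mathscr{D}^t$, $t=1,\dots,2^d$, in $\mathbb{R}^d$ such that $$\mathrm{BMO}_W^p=\bigcap_{t=1}^{2^d}\mathrm{BMO}^p_{W,\mathscr{D}^t}.$$
   Context: $n,d\ge 1$ are integers; $\mathcal{M}_n(\mathbb{C})$ is the algebra of $n\times n$ complex matrices with operator norm $\|\cdot\|$; $|\cdot|$ is the Euclidean norm on $\mathbb{C}^n$; cubes have sides parallel to the axes; $m_I F$ is the (entrywise) average of $F$ over $I$; $p'=p/(p-1)$. A measurable a.e. positive definite $W:\mathbb{R}^d\to\mathcal{M}_n(\mathbb{C})$ is a matrix $A_p$ weight if $$\|W\|_{A_p}:=\sup_{I\text{ cube}}\frac1{|I|}\int_I\Big(\frac1{|I|}\int_I\|W^{1/p}(x)W^{-1/p}(t)\|^{p'}dt\Big)^{p/p'}dx<\infty.$$ Reducing operators: for each cube $I$, $V_I$ and $V_I'$ are (any) positive definite matrices with $\rho(\vec e)\le|V_I\vec e|\le\sqrt n\,\rho(\vec e)$, $\rho(\vec e)=\big(\frac1{|I|}\int_I|W^{1/p}(x)\vec e|^p dx\big)^{1/p}$, and $\rho^*(\vec e)\le|V_I'\vec e|\le\sqrt n\,\rho^*(\vec e)$, $\rho^*(\vec e)=\big(\frac1{|I|}\int_I|W^{-1/p}(x)\vec e|^{p'}dx\big)^{1/p'}$, for all $\vec e\in\mathbb{C}^n$. A dyadic grid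 is a nested family of half-open cubes of side lengths $2^k$, $k\in\mathbb{Z}$, such that for each $k$ the cubes of side length $2^k$ partition $\mathbb{R}^d$. $\mathrm{BMO}_W^p$ is the space of locally integrable $B:\mathbb{R}^d\to\mathcal{M}_n(\mathbb{C})$ such that $$\sup_{I}\frac1{|I|}\int_I\|W^{1/p}(x)(B(x)-m_IB)V_I^{-1}\|^p\,dx<\infty\quad\text{if }2\le p<\infty,$$ $$\sup_{I}\frac1{|I|}\int_I\|W^{-1/p}(x)(B^*(x)-m_IB^* )(V_I')^{-1}\|^{p'}\,dx<\infty\quad\text{if }1<p\le2,$$ the supremum being over all cubes $I\subset\mathbb{R}^d$ (for $p=2$ either condition may be taken as the definition, consistently for both spaces). $\mathrm{BMO}^p_{W,\mathscr{D}}$ is defined in the same way with the supremum only over $I\in\mathscr{D}$. *)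

theory Defs
  imports "HOL-Analysis.Analysis"
begin

section \<open>Complex matrices\<close>

text \<open>The norm of \<^typ>\<open>complex^'n\<close> is the Euclidean norm. The norm of the type
  \<^typ>\<open>complex^'n^'n\<close> is the Frobenius norm, so the operator norm is defined separately.\<close>

definition op_norm :: "complex^'n^'n \<Rightarrow> real" where
  "op_norm A = onorm ((*v) A)"

definition conj_transpose :: "complex^'n^'n \<Rightarrow> complex^'n^'n" where
  "conj_transpose A = (\<chi> i j. cnj (A $ j $ i))"

text \<open>The real inner product \<open>v \<bullet> w\<close> of \<^typ>\<open>complex^'n\<close> is the real part of the
  Hermitian inner product.\<close>

definition pos_def :: "complex^'n^'n \<Rightarrow> bool" where
  "pos_def A \<longleftrightarrow> conj_transpose A = A \<and> (\<forall>v. v \<noteq> 0 \<longrightarrow> 0 < v \<bullet> (A *v v))"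

definition unitary :: "complex^'n^'n \<Rightarrow> bool" where
  "unitary U \<longleftrightarrow> conj_transpose U ** U = mat 1 \<and> U ** conj_transpose U = mat 1"

definition real_diag :: "('n \<Rightarrow> real) \<Rightarrow> complex^'n^'n" where
  "real_diag l = (\<chi> i j. if i = j then complex_of_real (l i) else 0)"

text \<open>Real powers \<open>A\<^sup>s\<close> of a positive definite matrix by the spectral theorem: the result does
  not depend on the diagonalization. For other matrices the value is irrelevant.\<close>

definition mat_powr :: "complex^'n^'n \<Rightarrow> real \<Rightarrow> complex^'n^'n" where
  "mat_powr A s = (THE B. \<exists>U l. unitary U \<and> (\<forall>i. 0 < l i) \<and>
      A = U ** real_diag l ** conj_transpose U \<and>
      B = U ** real_diag (\<lambda>i. l i powr s) ** conj_transpose U)"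


section \<open>Cubes and dyadic grids\<close>

text \<open>A cube is a product of bounded intervals of the same positive length; each of them may
  contain any of its endpoints or none.\<close>

definition is_cube :: "(real^'d) set \<Rightarrow> bool" where
  "is_cube I \<longleftrightarrow> (\<exists>a l J. 0 < l \<and>
      (\<forall>i. {a $ i <..< a $ i + l} \<subseteq> J i \<and> J i \<subseteq> {a $ i .. a $ i + l}) \<and>
      I = {x. \<forall>i. x $ i \<in> J i})"

definition half_open_cube :: "real^'d \<Rightarrow> real \<Rightarrow> (real^'d) set" where
  "half_open_cube a l = {x. \<forall>i. a $ i \<le> x $ i \<and> x $ i < a $ i + l}"

definition dyadic_grid :: "(real^'d) set set \<Rightarrow> bool" where
  "dyadic_grid D \<longleftrightarrow>
     (\<forall>Q\<in>D. \<exists>a (k::int). Q = half_open_cube a (2 powi k)) \<and>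
     (\<forall>Q\<in>D. \<forall>R\<in>D. Q \<inter> R = {} \<or> Q \<subseteq> R \<or> R \<subseteq> Q) \<and>
     (\<forall>k::int. partition_on UNIV {Q\<in>D. \<exists>a. Q = half_open_cube a (2 powi k)})"


section \<open>Averages\<close>

text \<open>Averages of nonnegative functions are extended real, hence always defined.\<close>

definition nn_avg :: "(real^'d) set \<Rightarrow> (real^'d \<Rightarrow> ennreal) \<Rightarrow> ennreal" where
  "nn_avg I f = (\<integral>\<^sup>+x\<in>I. f x \<partial>lebesgue) / emeasure lebesgue I"

text \<open>The power \<open>x\<^sup>s\<close> of an extended nonnegative real, for \<open>s > 0\<close>.\<close>

definition ennpowr :: "ennreal \<Rightarrow> real \<Rightarrow> ennreal" where
  "ennpowr x s = (if x = top then top else ennreal (enn2real x powr s))"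

definition mat_avg :: "(real^'d) set \<Rightarrow> (real^'d \<Rightarrow> complex^'n^'n) \<Rightarrow> complex^'n^'n" where
  "mat_avg I F =
     (\<chi> i j. (LINT x:I|lebesgue. F x $ i $ j) / complex_of_real (measure lebesgue I))"

definition locally_integrable :: "(real^'d \<Rightarrow> complex^'n^'n) \<Rightarrow> bool" where
  "locally_integrable F \<longleftrightarrow> (\<forall>K. compact K \<longrightarrow> set_integrable lebesgue K F)"


section \<open>Matrix weights, reducing operators and weighted BMO\<close>

definition conj_exp :: "real \<Rightarrow> real" where
  "conj_exp p = p / (p - 1)"

definition Ap_const :: "real \<Rightarrow> (real^'d \<Rightarrow> complex^'n^'n) \<Rightarrow> ennreal" where
  "Ap_const p W = (SUP I\<in>{I. is_cube I}.
     nn_avg I (\<lambda>x. ennpowr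
       (nn_avg I (\<lambda>t. ennreal
          (op_norm (mat_powr (W x) (1/p) ** mat_powr (W t) (-1/p)) powr conj_exp p)))
       (p / conj_exp p)))"

definition Ap_weight :: "real \<Rightarrow> (real^'d \<Rightarrow> complex^'n^'n) \<Rightarrow> bool" where
  "Ap_weight p W \<longleftrightarrow> W \<in> borel_measurable lebesgue \<and>
     (AE x in lebesgue. pos_def (W x)) \<and> Ap_const p W < top"

definition avg_norm ::
  "real \<Rightarrow> real \<Rightarrow> (real^'d \<Rightarrow> complex^'n^'n) \<Rightarrow> (real^'d) set \<Rightarrow> complex^'n \<Rightarrow> ennreal" where
  "avg_norm q s W I e =
     ennpowr (nn_avg I (\<lambda>x. ennreal (norm (mat_powr (W x) s *v e) powr q))) (1/q)"

text \<open>In the following, \<open>V\<^sub>I\<close> is obtained with \<open>q = p\<close>, \<open>s = 1/p\<close> and \<open>V\<^sub>I'\<close> with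
  \<open>q = p'\<close>, \<open>s = -1/p\<close>.\<close>

definition reducing_op ::
  "real \<Rightarrow> real \<Rightarrow> (real^'d \<Rightarrow> complex^'n^'n) \<Rightarrow> (real^'d) set \<Rightarrow> complex^'n^'n \<Rightarrow> bool" where
  "reducing_op q s W I A \<longleftrightarrow> pos_def A \<and>
     (\<forall>e. avg_norm q s W I e \<le> ennreal (norm (A *v e)) \<and>
          ennreal (norm (A *v e)) \<le> ennreal (sqrt (real CARD('n))) * avg_norm q s W I e)"

definition reducing_families ::
  "real \<Rightarrow> (real^'d \<Rightarrow> complex^'n^'n) \<Rightarrow>
   ((real^'d) set \<Rightarrow> complex^'n^'n) \<Rightarrow> ((real^'d) set \<Rightarrow> complex^'n^'n) \<Rightarrow> bool" where
  "reducing_families p W V V' \<longleftrightarrow> (\<forall>I. is_cube I \<longrightarrow>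
     reducing_op p (1/p) W I (V I) \<and> reducing_op (conj_exp p) (-1/p) W I (V' I))"

text \<open>The two conditions, for a collection \<open>\<C>\<close> of cubes.\<close>

definition bmo_sup ::
  "real \<Rightarrow> (real^'d \<Rightarrow> complex^'n^'n) \<Rightarrow> ((real^'d) set \<Rightarrow> complex^'n^'n) \<Rightarrow>
   (real^'d) set set \<Rightarrow> (real^'d \<Rightarrow> complex^'n^'n) \<Rightarrow> ennreal" where
  "bmo_sup p W V \<C> B = (SUP I\<in>\<C>. nn_avg I (\<lambda>x. ennreal
     (op_norm (mat_powr (W x) (1/p) ** (B x - mat_avg I B) ** matrix_inv (V I)) powr p)))"

definition bmo_sup_dual ::
  "real \<Rightarrow> (real^'d \<Rightarrow> complex^'n^'n) \<Rightarrow> ((real^'d) set \<Rightarrow> complex^'n^'n) \<Rightarrow>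
   (real^'d) set set \<Rightarrow> (real^'d \<Rightarrow> complex^'n^'n) \<Rightarrow> ennreal" where
  "bmo_sup_dual p W V' \<C> B = (SUP I\<in>\<C>. nn_avg I (\<lambda>x. ennreal
     (op_norm (mat_powr (W x) (-1/p) **
        (conj_transpose (B x) - mat_avg I (\<lambda>y. conj_transpose (B y))) **
        matrix_inv (V' I)) powr conj_exp p)))"

text \<open>The flag \<open>c\<close> matters only for \<open>p = 2\<close>, where it selects which of the two conditions
  is the definition. The space over all cubes is the case \<open>\<C> = {I. is_cube I}\<close>.\<close>

definition BMO ::
  "bool \<Rightarrow> real \<Rightarrow> (real^'d \<Rightarrow> complex^'n^'n) \<Rightarrow>
   ((real^'d) set \<Rightarrow> complex^'n^'n) \<Rightarrow> ((real^'d) set \<Rightarrow> complex^'n^'n) \<Rightarrow>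
   (real^'d) set set \<Rightarrow> (real^'d \<Rightarrow> complex^'n^'n) set" where
  "BMO c p W V V' \<C> = {B. locally_integrable B \<and>
     (if 2 < p \<or> (p = 2 \<and> c) then bmo_sup p W V \<C> B < top else bmo_sup_dual p W V' \<C> B < top)}"

end

theory Submission
  imports Defs
begin

text \<open>
  Every cube \<open>I\<close> lies in a cube \<open>J\<close> of comparable size from one of \<open>2\<^sup>d\<close> dyadic grids: in each
  coordinate one uses either the standard dyadic intervals or those shifted by a third of their
  length, and an interval of length less than a third of \<open>2\<^sup>k\<close> cannot meet the endpoints of level
  \<open>k\<close> of both (\<open>cube_in_shifted_grid\<close>). Since grid cubes are cubes, only one inclusion is in
  question, and it suffices to bound the weighted oscillation over \<open>I\<close> when the one over \<open>J\<close> is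
  bounded (\<open>oscillation_subcube\<close>).

  Let \<open>P\<close> and \<open>Q\<close> be the powers \<open>1/p\<close> and \<open>-1/p\<close> of the weight. The \<open>A\<^sub>p\<close> condition says that the
  reducing operators satisfy \<open>|V\<^sub>I V'\<^sub>I| \<le> C\<close> (\<open>Ap_reducing_bound\<close>). Hence a product \<open>V\<^sub>I X\<close> is
  dominated by \<open>V'\<^sub>I\<^sup>-\<^sup>1 X\<close>, and there one can insert \<open>Q(x) P(x) = 1\<close>, average over
  \<open>x\<close> and separate the factors by Young's inequality, because the averages of the powers \<open>p'\<close> and
  \<open>p\<close> of \<open>V'\<^sub>I\<^sup>-\<^sup>1 Q\<close> and \<open>P V\<^sub>I\<^sup>-\<^sup>1\<close> are bounded. Applied to \<open>V\<^sub>J V\<^sub>I\<^sup>-\<^sup>1\<close> this gives the doubling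
  property (\<open>reducing_doubling\<close>), which handles \<open>B - m\<^sub>J B\<close>; applied to \<open>V\<^sub>I (m\<^sub>I B - m\<^sub>J B) V\<^sub>I\<^sup>-\<^sup>1\<close> it
  handles the difference of the two means.

  The condition \<open>|V\<^sub>I V'\<^sub>I| \<le> C\<close> is symmetric, because the matrices are Hermitian. So the same argument
  with \<open>P\<close> and \<open>Q\<close>, \<open>p\<close> and \<open>p'\<close>, \<open>V\<close> and \<open>V'\<close> exchanged and the adjoint of
  \<open>B\<close> in place of \<open>B\<close> treats the second form of the BMO condition.

  Two facts about matrix powers enter: they are Hermitian with the expected inverses, which is the
  spectral theorem, and they depend measurably on the point, which follows by approximating
  \<open>x\<^sup>s\<close> by polynomials.
\<close>

section \<open>Norms and adjoints of matrices\<close>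

lemma norm_axis_one: "norm (axis j 1 :: complex^'n) = 1"
  by (simp add: norm_eq_sqrt_inner inner_axis_axis)

lemma matrix_mult_axis_1:
  fixes A :: "complex^'n^'n"
  shows "(A *v axis j 1) $ i = A $ i $ j"
  by (simp add: matrix_vector_mult_def axis_def if_distrib cong: if_cong)

lemma norm_matrix_vector_mult_le:
  fixes A :: "complex^'n^'m"
  shows "norm (A *v v) \<le> norm A * norm v"
proof -
  have row: "norm ((A *v v) $ i) \<le> norm (A $ i) * norm v" for i
  proof -
    have "norm ((A *v v) $ i) \<le> (\<Sum>j\<in>UNIV. norm (A $ i $ j) * norm (v $ j))"
      unfolding matrix_vector_mult_def by (simp flip: norm_mult add: norm_sum)
    also have "\<dots> \<le> norm (A $ i) * norm v"
      unfolding norm_vec_def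
      using L2_set_mult_ineq[of "\<lambda>j. norm (A $ i $ j)" "\<lambda>j. norm (v $ j)" UNIV] by simp
    finally show ?thesis .
  qed
  have "norm (A *v v) \<le> L2_set (\<lambda>i. norm (A $ i) * norm v) UNIV"
    unfolding norm_vec_def[of "A *v v"] by (rule L2_set_mono) (use row in auto)
  also have "\<dots> = norm A * norm v"
    unfolding norm_vec_def[of A] by (simp add: L2_set_left_distrib)
  finally show ?thesis .
qed

lemma norm_conj_transpose [simp]: "norm (conj_transpose A) = norm A"
proof -
  have "(norm (conj_transpose A))\<^sup>2 = (norm A)\<^sup>2"
    unfolding norm_vec_def L2_set_def conj_transpose_def
    by (simp add: sum_nonneg) (rule sum.swap)
  then show ?thesis by simp
qed

lemma conj_transpose_mult: "conj_transpose (A ** B) = conj_transpose B ** conj_transpose A"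
  by (simp add: conj_transpose_def matrix_matrix_mult_def vec_eq_iff mult.commute)

lemma conj_transpose_conj_transpose [simp]: "conj_transpose (conj_transpose A) = A"
  by (simp add: conj_transpose_def vec_eq_iff)

lemma conj_transpose_mat_1 [simp]: "conj_transpose (mat 1) = mat 1"
  by (auto simp: conj_transpose_def mat_def vec_eq_iff)

lemma matrix_mult_column:
  fixes A B :: "complex^'n^'n"
  shows "(A ** B) *v v = A *v (B *v v)"
  by (simp add: matrix_vector_mul_assoc)

text \<open>The norm of the matrix type is the Frobenius norm. It is the sum of squares over the columns,
  which reduces matrix estimates to the vectors that reducing operators speak about, and it differs
  from the operator norm by at most the factor \<open>n\<close>. Since only finiteness is at stake, all
  estimates below are carried out in it.\<close>

lemma norm_squared_columns:
  fixes A :: "complex^'n^'n"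
  shows "(norm A)\<^sup>2 = (\<Sum>j\<in>UNIV. (norm (A *v axis j 1))\<^sup>2)"
  by (simp add: matrix_mult_axis_1 norm_vec_def L2_set_def sum_nonneg)
     (rule sum.swap)

lemma norm_column_le:
  fixes A :: "complex^'n^'n"
  shows "norm (A *v axis j 1) \<le> norm A"
  using norm_matrix_vector_mult_le[of A "axis j 1"] by (simp add: norm_axis_one)

lemma norm_le_sum_columns:
  fixes A :: "complex^'n^'n"
  shows "norm A \<le> (\<Sum>j\<in>UNIV. norm (A *v axis j 1))"
proof -
  have "norm A = L2_set (\<lambda>j. norm (A *v axis j 1)) UNIV"
    using norm_squared_columns[of A] unfolding L2_set_def by (metis norm_ge_zero real_sqrt_unique)
  also have "\<dots> \<le> (\<Sum>j\<in>UNIV. norm (A *v axis j 1))"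
    by (rule L2_set_le_sum) auto
  finally show ?thesis .
qed

lemma norm_matrix_mult_le:
  fixes A B :: "complex^'n^'n"
  shows "norm (A ** B) \<le> norm A * norm B"
proof -
  have "(norm (A ** B))\<^sup>2 = (\<Sum>j\<in>UNIV. (norm (A *v (B *v axis j 1)))\<^sup>2)"
    unfolding norm_squared_columns[of "A ** B"] matrix_mult_column ..
  also have "\<dots> \<le> (\<Sum>j\<in>UNIV. (norm A * norm (B *v axis j 1))\<^sup>2)"
    by (intro sum_mono power_mono norm_matrix_vector_mult_le) auto
  also have "\<dots> = (norm A * norm B)\<^sup>2"
    unfolding power_mult_distrib norm_squared_columns[of B] by (simp add: sum_distrib_left)
  finally show ?thesis by (rule power2_le_imp_le) auto
qed

lemma bounded_bilinear_matrix_mult: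
  "bounded_bilinear ((**) :: complex^'n^'n \<Rightarrow> complex^'n^'n \<Rightarrow> complex^'n^'n)"
proof (rule bounded_bilinear.intro)
  show "\<exists>K. \<forall>(A::complex^'n^'n) (B::complex^'n^'n). norm (A ** B) \<le> norm A * norm B * K"
    by (rule exI[of _ 1]) (use norm_matrix_mult_le in auto)
qed (simp_all add: matrix_matrix_mult_def vec_eq_iff sum.distrib algebra_simps scaleR_right.sum)

lemma bounded_linear_conj_transpose:
  "bounded_linear (conj_transpose :: complex^'n^'n \<Rightarrow> _)"
  proof (rule bounded_linear_intro[where K=1])
  show "norm (conj_transpose A) \<le> norm A * 1" for A :: "complex^'n^'n" by simp
qed (simp_all add: conj_transpose_def vec_eq_iff)

lemma op_norm_le_norm: "op_norm A \<le> norm A"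
  unfolding op_norm_def by (rule onorm_le) (rule norm_matrix_vector_mult_le)

lemma op_norm_nonneg: "0 \<le> op_norm A"
  unfolding op_norm_def by (rule onorm_pos_le) simp

lemma norm_le_op_norm:
  fixes A :: "complex^'n^'n"
  shows "norm A \<le> real CARD('n) * op_norm A"
proof -
  have "norm (A *v axis j 1) \<le> op_norm A" for j
    unfolding op_norm_def using onorm[of "(*v) A" "axis j 1"] by (simp add: norm_axis_one)
  then have "(\<Sum>j\<in>UNIV. norm (A *v axis j 1)) \<le> (\<Sum>j\<in>(UNIV::'n set). op_norm A)"
    by (intro sum_mono)
  then show ?thesis using norm_le_sum_columns[of A] by simp
qed

lemma pos_def_invertible: "pos_def A \<Longrightarrow> invertible A"
proof -
  assume A: "pos_def A"
  have "\<forall>x. A *v x = 0 \<longrightarrow> x = 0"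
    using A unfolding pos_def_def by (metis inner_zero_right less_irrefl)
  then show ?thesis
    by (simp add: invertible_left_inverse matrix_left_invertible_ker)
qed

lemma matrix_inv_pos_def:
  assumes "pos_def A"
  shows "A ** matrix_inv A = mat 1" "matrix_inv A ** A = mat 1"
  using someI_ex[of "\<lambda>A'. A ** A' = mat 1 \<and> A' ** A = mat 1"] pos_def_invertible[OF assms]
  unfolding matrix_inv_def invertible_def by auto

text \<open>The real inner product is the real part of the Hermitian form, so a conjugate transpose
  moves across it.\<close>

lemma inner_adjoint:
  fixes A :: "complex^'n^'n"
  shows "(A *v v) \<bullet> w = v \<bullet> (conj_transpose A *v w)"
proof -
  have e: "x \<bullet> y = Re (cnj x * y)" for x y :: complex by (simp add: inner_complex_def)
  have "(A *v v) \<bullet> w = Re (\<Sum>i\<in>UNIV. \<Sum>j\<in>UNIV. cnj (A$i$j) * cnj (v$j) * w$i)"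
    unfolding inner_vec_def e matrix_vector_mult_def
    by (simp add: sum_distrib_right)
  also have "\<dots> = Re (\<Sum>j\<in>UNIV. \<Sum>i\<in>UNIV. cnj (A$i$j) * cnj (v$j) * w$i)"
    by (subst sum.swap) simp
  also have "\<dots> = v \<bullet> (conj_transpose A *v w)"
    unfolding inner_vec_def e matrix_vector_mult_def conj_transpose_def
    by (simp add: sum_distrib_left algebra_simps)
  finally show ?thesis .
qed

section \<open>The spectral theorem and matrix powers\<close>

text \<open>A maximizer \<open>v\<close> of the Rayleigh quotient on the unit sphere of \<open>N\<close> is an eigenvector: the
  quadratic form \<open>q x = \<mu> |x|\<^sup>2 - x \<bullet> L x\<close> is nonnegative on \<open>N\<close> and vanishes at \<open>v\<close>, so its
  derivative at \<open>v\<close> in the direction \<open>z = \<mu> v - L v\<close>, which is \<open>2 |z|\<^sup>2\<close>, must be zero.\<close>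

lemma self_adjoint_eigenvector_exists:
  fixes L :: "'a::euclidean_space \<Rightarrow> 'a"
  assumes L: "linear L" and sym: "\<And>x y. L x \<bullet> y = x \<bullet> L y"
    and N: "subspace N" and inv: "\<And>x. x \<in> N \<Longrightarrow> L x \<in> N" and w: "w \<in> N" "w \<noteq> 0"
  obtains v \<mu> where "v \<in> N" "norm v = 1" "L v = \<mu> *\<^sub>R v"
proof -
  define K where "K = N \<inter> sphere 0 1"
  have "compact K"
    unfolding K_def using closed_subspace[OF N] by (simp add: closed_Int_compact)
  moreover have "w /\<^sub>R norm w \<in> K"
    using w N by (simp add: K_def subspace_scale)
  then have "K \<noteq> {}" by blast
  moreover have "continuous_on K (\<lambda>x. x \<bullet> L x)"
    by (intro continuous_intros linear_continuous_on linear_conv_bounded_linear[THEN iffD1] L)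
  ultimately obtain v where v: "v \<in> K" and max: "\<And>x. x \<in> K \<Longrightarrow> x \<bullet> L x \<le> v \<bullet> L v"
    using continuous_attains_sup[of K "\<lambda>x. x \<bullet> L x"] by blast
  define \<mu> where "\<mu> = v \<bullet> L v"
  define q where "q x = \<mu> * (x \<bullet> x) - x \<bullet> L x" for x
  have vN: "v \<in> N" and v1: "v \<bullet> v = 1"
    using v by (auto simp: K_def norm_eq_1)
  have q_nonneg: "0 \<le> q x" if x: "x \<in> N" for x
  proof (cases "x = 0")
    case False
    define y where "y = x /\<^sub>R norm x"
    have xy: "x = norm x *\<^sub>R y" using False by (simp add: y_def)
    have "y \<in> K" using False x N by (simp add: K_def y_def subspace_scale)
    from max[OF this] have "y \<bullet> L y \<le> \<mu>" by (simp add: \<mu>_def)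
    moreover have "x \<bullet> L x = (norm x)\<^sup>2 * (y \<bullet> L y)"
      by (subst (1 2) xy) (simp add: linear_cmul[OF L] power2_eq_square)
    ultimately show ?thesis
      unfolding q_def power2_norm_eq_inner[symmetric]
      by (simp add: mult_right_mono mult.commute)
  qed (simp add: q_def)
  define z where "z = \<mu> *\<^sub>R v - L v"
  have zN: "z \<in> N"
    unfolding z_def using N vN inv by (simp add: subspace_diff subspace_scale)
  have expand: "q (v + t *\<^sub>R z) = t * (2 * (z \<bullet> z) + t * q z)" for t
  proof -
    have "v \<bullet> L z = z \<bullet> L v" by (metis inner_commute sym)
    then have "q (v + t *\<^sub>R z) = q v + 2 * t * (z \<bullet> (\<mu> *\<^sub>R v - L v)) + t * t * q z"
      unfolding q_def
      by (simp add: linear_add[OF L] linear_cmul[OF L] inner_simps inner_commute algebra_simps)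
    moreover have "q v = 0" by (simp add: q_def \<mu>_def v1)
    ultimately show ?thesis by (simp add: z_def[symmetric] algebra_simps)
  qed
  have "z = 0"
  proof (rule ccontr)
    assume "z \<noteq> 0"
    then have zz: "0 < z \<bullet> z" by simp
    \<comment> \<open>a step backwards, short enough for the linear term to outweigh the quadratic one\<close>
    define t where "t = - (z \<bullet> z) / (q z + 1)"
    have qz: "0 \<le> q z" using q_nonneg[OF zN] .
    have t: "t < 0" unfolding t_def using zz qz by (simp add: field_simps)
    have "t * q z = - (z \<bullet> z) * (q z / (q z + 1))" by (simp add: t_def)
    moreover have "q z / (q z + 1) < 1" using qz by simp
    ultimately have "- (z \<bullet> z) < t * q z"
      using mult_strict_left_mono[OF _ zz, of "q z / (q z + 1)" 1] by simp
    then have "0 < 2 * (z \<bullet> z) + t * q z" using zz by linarith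
    then have "q (v + t *\<^sub>R z) < 0"
      unfolding expand using t by (simp add: mult_neg_pos)
    moreover have "v + t *\<^sub>R z \<in> N" using N vN zN by (simp add: subspace_add subspace_scale)
    ultimately show False using q_nonneg by fastforce
  qed
  then have "L v = \<mu> *\<^sub>R v" by (simp add: z_def)
  moreover have "norm v = 1" using v by (simp add: K_def)
  ultimately show thesis using that vN by blast
qed

text \<open>Eigenvectors are added one at a time, in the orthogonal complement of those already found.
  Hermitian orthogonality is two real equations, orthogonality to \<open>f i\<close> and to \<open>\<i> f i\<close>, so the
  complement is cut out by at most \<open>2 |T|\<close> real conditions in real dimension \<open>2 n\<close>; it is nonzero
  as long as \<open>T\<close> is not the whole index set, and \<open>A\<close> maps it to itself.\<close>

lemma hermitian_orthonormal_eigenvectors: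
  fixes A :: "complex^'n^'n" and T :: "'n set"
  assumes A: "conj_transpose A = A" and "finite T"
  shows "\<exists>f l. (\<forall>j\<in>T. A *v f j = l j *\<^sub>R f j \<and> norm (f j :: complex^'n) = 1) \<and>
     (\<forall>i\<in>T. \<forall>j\<in>T. i \<noteq> j \<longrightarrow> f i \<bullet> f j = 0 \<and> (\<i> *s f i) \<bullet> f j = 0)"
  using \<open>finite T\<close>
proof induction
  case (insert a T)
  from insert.IH obtain f :: "'n \<Rightarrow> complex^'n" and l
    where IH: "(\<forall>j\<in>T. A *v f j = l j *\<^sub>R f j \<and> norm (f j) = 1) \<and>
     (\<forall>i\<in>T. \<forall>j\<in>T. i \<noteq> j \<longrightarrow> f i \<bullet> f j = 0 \<and> (\<i> *s f i) \<bullet> f j = 0)"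
    by (elim exE)
  have fl: "\<And>j. j \<in> T \<Longrightarrow> A *v f j = l j *\<^sub>R f j" "\<And>j. j \<in> T \<Longrightarrow> norm (f j) = 1"
    and orth: "\<And>i j. i \<in> T \<Longrightarrow> j \<in> T \<Longrightarrow> i \<noteq> j \<Longrightarrow> f i \<bullet> f j = 0 \<and> (\<i> *s f i) \<bullet> f j = 0"
    using IH by simp_all
  define S where "S = f ` T \<union> (\<lambda>i. \<i> *s f i) ` T"
  define N where "N = {w. \<forall>u\<in>S. u \<bullet> w = 0}"
  have "card T < CARD('n)"
    using insert.hyps card_mono[of UNIV "insert a T"] by simp
  moreover have "card S \<le> card T + card T"
    unfolding S_def using card_image_le[OF insert.hyps(1), of f]
      card_image_le[OF insert.hyps(1), of "\<lambda>i. \<i> *s f i"] card_Un_le[of "f ` T" "(\<lambda>i. \<i> *s f i) ` T"]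
    by linarith
  moreover have "dim S \<le> card S"
    using insert.hyps by (intro dim_le_card') (simp add: S_def)
  ultimately have "dim S < DIM(complex^'n)" by simp
  then obtain w where w: "w \<noteq> 0" "\<And>y. y \<in> span S \<Longrightarrow> orthogonal w y"
    using orthogonal_to_subspace_exists[of S] by metis
  have wN: "w \<in> N"
    using w(2) by (auto simp: N_def orthogonal_def inner_commute span_base)
  have subN: "subspace N"
    unfolding N_def subspace_def by (auto simp: inner_simps)
  have AS: "\<exists>c. A *v u = c *\<^sub>R u" if u: "u \<in> S" for u
  proof -
    obtain j where j: "j \<in> T" "u = f j \<or> u = \<i> *s f j" using u unfolding S_def by blast
    have "A *v (\<i> *s f j) = \<i> *s (A *v f j)"
      by (simp add: matrix_vector_mult_def vec_eq_iff sum_distrib_left algebra_simps)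
    also have "\<dots> = l j *\<^sub>R (\<i> *s f j)" using fl(1)[OF j(1)] by (simp add: vec_eq_iff)
    finally show ?thesis using j fl(1)[OF j(1)] by blast
  qed
  have sym: "(A *v x) \<bullet> y = x \<bullet> (A *v y)" for x y
    using inner_adjoint[of A x y] A by simp
  have inv: "A *v x \<in> N" if "x \<in> N" for x
    unfolding N_def
  proof (safe)
    fix u assume u: "u \<in> S"
    then obtain c where "A *v u = c *\<^sub>R u" using AS by blast
    then show "u \<bullet> (A *v x) = 0" using that u by (simp add: sym[symmetric] N_def)
  qed
  obtain v \<mu> where v: "v \<in> N" "norm v = 1" "A *v v = \<mu> *\<^sub>R v"
    by (rule self_adjoint_eigenvector_exists[of "(*v) A" N w])
      (use sym subN inv wN w(1) in auto)
  have fv: "f i \<bullet> v = 0" "(\<i> *s f i) \<bullet> v = 0" if "i \<in> T" for i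
    using v(1) that by (auto simp: N_def S_def)
  have vf: "v \<bullet> f i = 0" "(\<i> *s v) \<bullet> f i = 0" if "i \<in> T" for i
  proof -
    show "v \<bullet> f i = 0" using fv[OF that] by (simp add: inner_commute)
    have "(\<i> *s v) \<bullet> f i = - ((\<i> *s f i) \<bullet> v)"
      by (simp add: inner_vec_def inner_complex_def sum_negf[symmetric] algebra_simps)
    then show "(\<i> *s v) \<bullet> f i = 0" using fv[OF that] by simp
  qed
  have aT: "a \<notin> T" by fact
  have "\<forall>j\<in>insert a T. A *v (f(a:=v)) j = (l(a:=\<mu>)) j *\<^sub>R (f(a:=v)) j \<and> norm ((f(a:=v)) j) = 1"
    using v fl by auto
  moreover have "\<forall>i\<in>insert a T. \<forall>j\<in>insert a T. i \<noteq> j \<longrightarrow>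
      (f(a:=v)) i \<bullet> (f(a:=v)) j = 0 \<and> (\<i> *s (f(a:=v)) i) \<bullet> (f(a:=v)) j = 0"
    using orth vf fv aT by auto
  ultimately show ?case by blast
qed simp

lemma unitary_cancel:
  assumes "unitary U"
  shows "conj_transpose U ** U = mat 1" "U ** conj_transpose U = mat 1"
    "conj_transpose U ** (U ** X) = X" "U ** (conj_transpose U ** X) = X"
  using assms by (simp_all add: unitary_def matrix_mul_assoc)

lemma hermitian_spectral:
  fixes A :: "complex^'n^'n"
  assumes A: "conj_transpose A = A"
  obtains U l where "unitary U" "A = U ** real_diag l ** conj_transpose U"
proof -
  obtain f :: "'n \<Rightarrow> complex^'n" and l
    where fl: "\<And>j. A *v f j = l j *\<^sub>R f j" "\<And>j. norm (f j) = 1"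
    and orth: "\<And>i j. i \<noteq> j \<Longrightarrow> f i \<bullet> f j = 0 \<and> (\<i> *s f i) \<bullet> f j = 0"
    using hermitian_orthonormal_eigenvectors[OF A finite]
    by (metis UNIV_I)
  define U :: "complex^'n^'n" where "U = (\<chi> i j. f j $ i)"
  have herm: "(\<Sum>k\<in>UNIV. cnj (u $ k) * v $ k) = Complex (u \<bullet> v) ((\<i> *s u) \<bullet> v)"
    for u v :: "complex^'n"
    by (simp add: complex_eq_iff inner_vec_def inner_complex_def algebra_simps)
  have self: "(\<i> *s u) \<bullet> u = 0" for u :: "complex^'n"
    by (simp add: inner_vec_def inner_complex_def)
  have "conj_transpose U ** U = mat 1"
    unfolding vec_eq_iff
  proof (intro allI)
    fix i j
    have "(conj_transpose U ** U) $ i $ j = Complex (f i \<bullet> f j) ((\<i> *s f i) \<bullet> f j)"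
      unfolding herm[symmetric] by (simp add: conj_transpose_def matrix_matrix_mult_def U_def)
    also have "\<dots> = (if i = j then 1 else 0)"
      using orth[of i j] fl(2)[of i] self[of "f i"]
      by (cases "i = j") (simp_all add: norm_eq_1 complex_eq_iff)
    finally show "(conj_transpose U ** U) $ i $ j = (mat 1 :: complex^'n^'n) $ i $ j"
      by (simp add: mat_def)
  qed
  then have U: "unitary U" unfolding unitary_def by (simp add: matrix_left_right_inverse)
  have "A ** U = U ** real_diag l"
    unfolding vec_eq_iff
  proof (intro allI)
    fix i j
    have "(A ** U) $ i $ j = (A *v f j) $ i"
      by (simp add: matrix_matrix_mult_def matrix_vector_mult_def U_def)
    also have "\<dots> = f j $ i * complex_of_real (l j)"
      by (simp add: fl(1)) (simp add: scaleR_conv_of_real mult.commute)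
    also have "\<dots> = (U ** real_diag l) $ i $ j"
      by (simp add: matrix_matrix_mult_def U_def real_diag_def if_distrib cong: if_cong)
    finally show "(A ** U) $ i $ j = (U ** real_diag l) $ i $ j" .
  qed
  then have "A = U ** real_diag l ** conj_transpose U"
    by (metis matrix_mul_assoc matrix_mul_rid unitary_cancel(2)[OF U])
  with U that show thesis by blast
qed

lemma pos_def_spectral:
  fixes A :: "complex^'n^'n"
  assumes A: "pos_def A"
  obtains U l where "unitary U" "\<And>i. 0 < l i" "A = U ** real_diag l ** conj_transpose U"
proof -
  obtain U l where U: "unitary U" and Ae: "A = U ** real_diag l ** conj_transpose U"
    using hermitian_spectral A unfolding pos_def_def by blast
  have "0 < l i" for i
  proof -
    define v where "v = U *v axis i 1"
    have Uv: "conj_transpose U *v v = axis i 1"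
      using U unfolding v_def unitary_def by (simp add: matrix_vector_mul_assoc)
    then have "v \<noteq> 0" by (auto simp: axis_eq_0_iff)
    then have "0 < v \<bullet> (A *v v)" using A by (simp add: pos_def_def)
    also have "A *v v = U *v (real_diag l *v axis i 1)"
      unfolding Ae by (simp add: Uv matrix_vector_mul_assoc[symmetric])
    also have "v \<bullet> \<dots> = axis i 1 \<bullet> (real_diag l *v axis i 1)"
      using inner_adjoint[of "conj_transpose U" v] Uv by simp
    also have "\<dots> = l i"
      by (simp add: inner_axis' matrix_mult_axis_1 real_diag_def inner_complex_def)
    finally show ?thesis .
  qed
  with U Ae that show thesis by blast
qed

lemma matrix_mult_real_diag:
  "(M ** real_diag c) $ i $ j = M $ i $ j * complex_of_real (c j)"
  "(real_diag c ** M) $ i $ j = complex_of_real (c i) * M $ i $ j"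
  by (simp_all add: matrix_matrix_mult_def real_diag_def if_distrib if_distribR cong: if_cong)

lemma real_diag_mult: "real_diag a ** real_diag b = real_diag (\<lambda>i. a i * b i)"
  by (simp add: vec_eq_iff matrix_mult_real_diag) (simp add: real_diag_def)

lemma real_diag_1: "real_diag (\<lambda>_. 1) = mat 1"
  by (auto simp: real_diag_def mat_def vec_eq_iff)

lemma conj_transpose_real_diag: "conj_transpose (real_diag l) = real_diag l"
  by (auto simp: real_diag_def conj_transpose_def vec_eq_iff)

lemma unitary_conjugate_mult:
  assumes "unitary U"
  shows "(U ** real_diag a ** conj_transpose U) ** (U ** real_diag b ** conj_transpose U)
    = U ** real_diag (\<lambda>i. a i * b i) ** conj_transpose U"
  by (simp add: real_diag_mult[symmetric] unitary_cancel[OF assms] matrix_mul_assoc[symmetric])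

text \<open>Functions of a diagonalized matrix do not depend on the diagonalization: \<open>M = conj_transpose V ** U\<close>
  intertwines the two diagonal matrices, so an entry of \<open>M\<close> can be nonzero only where the
  corresponding eigenvalues agree, and there \<open>g\<close> takes the same value.\<close>

lemma diagonalization_function_unique:
  fixes U V :: "complex^'n^'n"
  assumes U: "unitary U" and V: "unitary V"
    and eq: "U ** real_diag a ** conj_transpose U = V ** real_diag b ** conj_transpose V"
  shows "U ** real_diag (\<lambda>i. g (a i)) ** conj_transpose U =
    V ** real_diag (\<lambda>i. g (b i)) ** conj_transpose V"
proof -
  define M where "M = conj_transpose V ** U"
  have "conj_transpose V ** (U ** real_diag a ** conj_transpose U) ** U =
      conj_transpose V ** (V ** real_diag b ** conj_transpose V) ** U"
    unfolding eq ..
  then have ab: "M ** real_diag a = real_diag b ** M"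
    by (simp add: M_def unitary_cancel[OF U] unitary_cancel[OF V] matrix_mul_assoc[symmetric])
  have "M $ i $ j = 0 \<or> a j = b i" for i j
  proof -
    have "M $ i $ j * complex_of_real (a j) = complex_of_real (b i) * M $ i $ j"
      using ab matrix_mult_real_diag by metis
    then show ?thesis by (auto simp: mult.commute)
  qed
  then have "M $ i $ j * complex_of_real (g (a j)) = complex_of_real (g (b i)) * M $ i $ j" for i j
    by (metis mult.commute mult_zero_left)
  then have gg: "M ** real_diag (\<lambda>i. g (a i)) = real_diag (\<lambda>i. g (b i)) ** M"
    unfolding vec_eq_iff by (simp add: matrix_mult_real_diag)
  then have "V ** (M ** real_diag (\<lambda>i. g (a i))) ** conj_transpose U =
      V ** (real_diag (\<lambda>i. g (b i)) ** M) ** conj_transpose U"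
    by simp
  then show ?thesis
    by (simp add: M_def unitary_cancel[OF U] unitary_cancel[OF V] matrix_mul_assoc[symmetric])
qed

lemma mat_powr_eq:
  assumes "unitary U" "\<And>i. 0 < l i"
  shows "mat_powr (U ** real_diag l ** conj_transpose U) s =
    U ** real_diag (\<lambda>i. l i powr s) ** conj_transpose U"
  unfolding mat_powr_def
proof (rule the_equality)
  show "\<exists>U' l'. unitary U' \<and> (\<forall>i. 0 < l' i) \<and>
      U ** real_diag l ** conj_transpose U = U' ** real_diag l' ** conj_transpose U' \<and>
      U ** real_diag (\<lambda>i. l i powr s) ** conj_transpose U =
      U' ** real_diag (\<lambda>i. l' i powr s) ** conj_transpose U'"
    using assms by blast
next
  fix B
  assume "\<exists>U' l'. unitary U' \<and> (\<forall>i. 0 < l' i) \<and>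
      U ** real_diag l ** conj_transpose U = U' ** real_diag l' ** conj_transpose U' \<and>
      B = U' ** real_diag (\<lambda>i. l' i powr s) ** conj_transpose U'"
  then show "B = U ** real_diag (\<lambda>i. l i powr s) ** conj_transpose U"
    using diagonalization_function_unique[OF assms(1), where g="\<lambda>x. x powr s"] by metis
qed

lemma conj_transpose_mat_powr:
  assumes "pos_def A"
  shows "conj_transpose (mat_powr A s) = mat_powr A s"
proof -
  obtain U l where "unitary U" "\<And>i. 0 < l i" "A = U ** real_diag l ** conj_transpose U"
    using pos_def_spectral[OF assms] by blast
  then show ?thesis
    by (simp add: mat_powr_eq conj_transpose_mult conj_transpose_real_diag matrix_mul_assoc)
qed

lemma mat_powr_mult_minus:
  assumes "pos_def A"
  shows "mat_powr A s ** mat_powr A (- s) = mat 1"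
proof -
  obtain U l where *: "unitary U" "\<And>i. 0 < l i" "A = U ** real_diag l ** conj_transpose U"
    using pos_def_spectral[OF assms] by blast
  have "l i powr s * l i powr (- s) = 1" for i
    using *(2)[of i] by (simp flip: powr_add)
  then show ?thesis
    using * by (simp add: mat_powr_eq unitary_conjugate_mult real_diag_1 unitary_cancel)
qed

primrec mat_pow :: "complex^'n^'n \<Rightarrow> nat \<Rightarrow> complex^'n^'n" where
  "mat_pow A 0 = mat 1"
| "mat_pow A (Suc k) = mat_pow A k ** A"

lemma continuous_mat_pow: "continuous_on S (\<lambda>A. mat_pow A k)"
  by (induction k)
    (auto intro!: continuous_intros bounded_bilinear.continuous_on[OF bounded_bilinear_matrix_mult])

lemma mat_pow_diag:
  assumes "unitary U"
  shows "mat_pow (U ** real_diag l ** conj_transpose U) k = U ** real_diag (\<lambda>i. l i ^ k) ** conj_transpose U"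
proof (induction k)
  case 0
  then show ?case using assms by (simp add: real_diag_1 unitary_cancel)
next
  case (Suc k)
  then show ?case by (simp add: unitary_conjugate_mult[OF assms] mult.commute)
qed

lemma real_diag_sum:
  "real_diag (\<lambda>i. \<Sum>k\<in>K. c k * f k i) = (\<Sum>k\<in>K. c k *\<^sub>R real_diag (f k))"
  by (simp add: vec_eq_iff real_diag_def) (simp add: scaleR_conv_of_real)

lemma tendsto_real_diag:
  assumes "\<And>i. ((\<lambda>m. f m i) \<longlongrightarrow> l i) F"
  shows "((\<lambda>m. real_diag (f m)) \<longlongrightarrow> real_diag l) F"
  unfolding real_diag_def by (intro vec_tendstoI) (use assms in \<open>auto intro!: tendsto_of_real\<close>)

text \<open>Polynomials that converge to \<open>x powr s\<close> on the positive axis do so at the eigenvalues of any positive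
  definite matrix. This makes \<open>mat_powr\<close> a pointwise limit of continuous functions, which is how
  the measurability of the powers of a weight is obtained.\<close>

lemma mat_powr_limit_of_polynomials:
  obtains F :: "nat \<Rightarrow> complex^'n^'n \<Rightarrow> complex^'n^'n"
  where "\<And>m. continuous_on UNIV (F m)" "\<And>A. pos_def A \<Longrightarrow> (\<lambda>m. F m A) \<longlonglongrightarrow> mat_powr A s"
proof -
  \<comment> \<open>these intervals exhaust the positive axis\<close>
  have "\<exists>c n. \<forall>x\<in>{1 / real (Suc m) .. real (Suc m)}.
      \<bar>x powr s - (\<Sum>i\<le>n. c i * x ^ i)\<bar> < 1 / real (Suc m)" for m :: nat
  proof -
    obtain g :: "real \<Rightarrow> real" where g: "real_polynomial_function g"
      "\<And>x. x \<in> {1 / real (Suc m) .. real (Suc m)} \<Longrightarrow> \<bar>x powr s - g x\<bar> < 1 / real (Suc m)"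
    proof (rule Stone_Weierstrass_real_polynomial_function
        [of "{1 / real (Suc m) .. real (Suc m)}" "\<lambda>x. x powr s" "1 / real (Suc m)"])
      have "x \<noteq> 0" if "x \<in> {1 / real (Suc m) .. real (Suc m)}" for x
        using that by (auto simp: field_simps)
      then show "continuous_on {1 / real (Suc m) .. real (Suc m)} (\<lambda>x. x powr s)"
        by (intro continuous_intros) auto
    qed auto
    then show ?thesis unfolding real_polynomial_function_iff_sum by blast
  qed
  then obtain c n where cn: "\<And>m x. x \<in> {1 / real (Suc m) .. real (Suc m)} \<Longrightarrow>
      \<bar>x powr s - (\<Sum>i\<le>n m. c m i * x ^ i)\<bar> < 1 / real (Suc m)"
    by metis
  define F :: "nat \<Rightarrow> complex^'n^'n \<Rightarrow> complex^'n^'n" where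
    "F m A = (\<Sum>i\<le>n m. c m i *\<^sub>R mat_pow A i)" for m A
  have scalar: "(\<lambda>m. \<Sum>i\<le>n m. c m i * x ^ i) \<longlonglongrightarrow> x powr s" if x: "0 < x" for x
  proof (rule Lim_transform_bound[where f="\<lambda>m. x powr s - (\<Sum>i\<le>n m. c m i * x ^ i)" 
        and g="\<lambda>m. 1 / real (Suc m)", THEN tendsto_diff[OF tendsto_const[of "x powr s"]], simplified])
    obtain N :: nat where N: "max x (1 / x) < real N" using reals_Archimedean2 by blast
    have "norm (x powr s - (\<Sum>i\<le>n m. c m i * x ^ i)) \<le> norm (1 / real (Suc m))" if "N \<le> m" for m
    proof -
      have "max x (1 / x) \<le> real (Suc m)" using N that by linarith
      then have "x \<in> {1 / real (Suc m) .. real (Suc m)}" using x by (auto simp: field_simps)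
      from cn[OF this] show ?thesis by simp
    qed
    then show "\<forall>\<^sub>F m in sequentially. \<bar>x powr s - (\<Sum>i\<le>n m. c m i * x ^ i)\<bar> \<le> 1 / (1 + real m)"
      unfolding eventually_sequentially by force
    show "(\<lambda>m. 1 / (1 + real m)) \<longlonglongrightarrow> 0"
      using LIMSEQ_Suc[OF lim_1_over_n] by simp
  qed
  have "(\<lambda>m. F m A) \<longlonglongrightarrow> mat_powr A s" if A: "pos_def A" for A
  proof -
    obtain U l where U: "unitary U" and l: "\<And>i. 0 < l i" and Ae: "A = U ** real_diag l ** conj_transpose U"
      using pos_def_spectral[OF A] by blast
    interpret bounded_bilinear "(**) :: complex^'n^'n \<Rightarrow> complex^'n^'n \<Rightarrow> complex^'n^'n"
      by (rule bounded_bilinear_matrix_mult)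
    have "F m A = U ** real_diag (\<lambda>j. \<Sum>i\<le>n m. c m i * l j ^ i) ** conj_transpose U" for m
      unfolding F_def Ae mat_pow_diag[OF U] real_diag_sum
      by (simp add: sum_left sum_right scaleR_left scaleR_right)
    moreover have "mat_powr A s = U ** real_diag (\<lambda>j. l j powr s) ** conj_transpose U"
      unfolding Ae by (rule mat_powr_eq[OF U l])
    moreover have "(\<lambda>m. U ** real_diag (\<lambda>j. \<Sum>i\<le>n m. c m i * l j ^ i) ** conj_transpose U) \<longlonglongrightarrow>
        U ** real_diag (\<lambda>j. l j powr s) ** conj_transpose U"
      by (intro tendsto tendsto_const tendsto_real_diag scalar l)
    ultimately show ?thesis by simp
  qed
  moreover have "continuous_on UNIV (F m)" for m
    unfolding F_def by (intro continuous_intros continuous_mat_pow)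
  ultimately show thesis using that by blast
qed

lemma measurable_mat_powr:
  fixes W :: "real^'d \<Rightarrow> complex^'n^'n"
  assumes W: "W \<in> borel_measurable lebesgue" and pd: "AE x in lebesgue. pos_def (W x)"
  shows "(\<lambda>x. mat_powr (W x) s) \<in> borel_measurable lebesgue"
proof -
  obtain F :: "nat \<Rightarrow> complex^'n^'n \<Rightarrow> complex^'n^'n" where
    F: "\<And>m. continuous_on UNIV (F m)" "\<And>A. pos_def A \<Longrightarrow> (\<lambda>m. F m A) \<longlonglongrightarrow> mat_powr A s"
    using mat_powr_limit_of_polynomials[of s] by blast
  have "(\<lambda>x. F m (W x)) \<in> borel_measurable lebesgue" for m
    using borel_measurable_continuous_on[OF F(1) W] .
  then have "(\<lambda>x. lim (\<lambda>m. F m (W x))) \<in> borel_measurable lebesgue"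
    by (rule borel_measurable_lim_metric)
  moreover have "AE x in lebesgue. lim (\<lambda>m. F m (W x)) = mat_powr (W x) s"
    using pd by eventually_elim (rule limI[OF F(2)])
  ultimately show ?thesis by (rule borel_measurable_AE)
qed

section \<open>Averages over cubes\<close>

lemma is_cube_between_boxes:
  fixes I :: "(real^'d) set"
  assumes "is_cube I"
  obtains a l where "0 < l" "box a (\<chi> i. a $ i + l) \<subseteq> I" "I \<subseteq> cbox a (\<chi> i. a $ i + l)"
proof -
  obtain a l J where "0 < l"
    and J: "\<And>i. {a $ i <..< a $ i + l} \<subseteq> J i" "\<And>i. J i \<subseteq> {a $ i .. a $ i + l}"
    and I: "I = {x. \<forall>i. x $ i \<in> J i}"
    using assms unfolding is_cube_def by blast
  moreover have "box a (\<chi> i. a $ i + l) \<subseteq> I"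
    using J(1) unfolding I by (force simp: mem_box_cart)
  moreover have "I \<subseteq> cbox a (\<chi> i. a $ i + l)"
    using J(2) unfolding I by (force simp: mem_box_cart)
  ultimately show thesis using that by blast
qed

text \<open>A cube differs from its interior by part of the boundary, a null set.\<close>

lemma between_boxes_lebesgue:
  fixes I :: "(real^'d) set"
  assumes l: "0 < l" and box: "box a (\<chi> i. a $ i + l) \<subseteq> I" and cbox: "I \<subseteq> cbox a (\<chi> i. a $ i + l)"
  shows "I \<in> sets lebesgue" "emeasure lebesgue I = ennreal (l ^ CARD('d))"
proof -
  let ?B = "box a (\<chi> i. a $ i + l)" and ?C = "cbox a (\<chi> i. a $ i + l)"
  have "I - ?B \<subseteq> ?C - ?B" using cbox by blast
  moreover have "?C - ?B \<in> null_sets lebesgue"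
    by (rule null_sets_completionI[OF null_sets_cbox_Diff_box])
  ultimately have null: "I - ?B \<in> null_sets lebesgue"
    using completion.complete2 by blast
  have I: "I = ?B \<union> (I - ?B)" using box by blast
  show meas: "I \<in> sets lebesgue"
    by (subst I, rule sets.Un) (use null in \<open>simp_all add: null_setsD2\<close>)
  have "measure lborel ?C = (\<Prod>i\<in>(UNIV::'d set). l)"
    using l by (subst content_cbox_cart) (auto simp: interval_ne_empty_cart)
  moreover have "emeasure lborel ?C = ennreal (measure lborel ?C)"
    using emeasure_lborel_cbox_finite[of a "\<chi> i. a $ i + l"]
    by (intro emeasure_eq_ennreal_measure) simp
  ultimately have C: "emeasure lebesgue ?C = ennreal (l ^ CARD('d))" by simp
  have "emeasure lebesgue ?B = emeasure lebesgue ?C"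
    by (simp add: emeasure_lborel_box_eq emeasure_lborel_cbox_eq)
  moreover have "emeasure lebesgue I = emeasure lebesgue ?B"
    by (subst I) (rule emeasure_Un_null_set, use null in auto)
  ultimately show "emeasure lebesgue I = ennreal (l ^ CARD('d))" using C by simp
qed

lemma is_cube_lebesgue:
  assumes "is_cube I"
  shows "I \<in> sets lebesgue" "0 < measure lebesgue I" "emeasure lebesgue I = ennreal (measure lebesgue I)"
proof -
  obtain a l where *: "0 < l" "box a (\<chi> i. a $ i + l) \<subseteq> I" "I \<subseteq> cbox a (\<chi> i. a $ i + l)"
    using is_cube_between_boxes[OF assms] by metis
  note ** = between_boxes_lebesgue[OF this]
  show "I \<in> sets lebesgue" by fact
  show "0 < measure lebesgue I" "emeasure lebesgue I = ennreal (measure lebesgue I)"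
    using **(2) *(1) by (simp_all add: measure_def)
qed

lemma nn_avg_mono:
  assumes "AE x in lebesgue. x \<in> I \<longrightarrow> f x \<le> g x"
  shows "nn_avg I f \<le> nn_avg I g"
  unfolding nn_avg_def
  by (intro divide_right_mono_ennreal nn_integral_mono_AE)
    (use assms in eventually_elim, auto split: split_indicator)

lemma nn_avg_cmult:
  assumes "is_cube I" "f \<in> borel_measurable lebesgue"
  shows "nn_avg I (\<lambda>x. c * f x) = c * nn_avg I f"
  using assms is_cube_lebesgue(1)[OF assms(1)]
  by (simp add: nn_avg_def mult.assoc nn_integral_cmult ennreal_times_divide)

lemma nn_avg_add:
  assumes "is_cube I" "f \<in> borel_measurable lebesgue" "g \<in> borel_measurable lebesgue"
  shows "nn_avg I (\<lambda>x. f x + g x) = nn_avg I f + nn_avg I g"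
  using assms is_cube_lebesgue(1)[OF assms(1)]
  by (simp add: nn_avg_def distrib_right nn_integral_add add_divide_distrib_ennreal)

lemma nn_avg_const:
  assumes "is_cube I"
  shows "nn_avg I (\<lambda>x. c) = c"
  using is_cube_lebesgue[OF assms]
  by (simp add: nn_avg_def nn_integral_cmult_indicator ennreal_mult_divide_eq)

lemma nn_avg_sum:
  assumes "is_cube I" "finite S" "\<And>j. j \<in> S \<Longrightarrow> f j \<in> borel_measurable lebesgue"
  shows "nn_avg I (\<lambda>x. \<Sum>j\<in>S. f j x) = (\<Sum>j\<in>S. nn_avg I (f j))"
  using assms(2,3)
proof (induction S rule: finite_induct)
  case empty
  then show ?case using nn_avg_const[OF assms(1), of 0] by simp
next
  case (insert a S)
  then show ?case by (simp add: nn_avg_add[OF assms(1)])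
qed

text \<open>The constant is carried by the smaller function \<open>f\<close>, whose measurability is known. The larger
  function \<open>g\<close> can then be an expression in the operator norm, or an inner average as in the
  \<open>A\<^sub>p\<close> condition.\<close>

lemma nn_avg_le_cmult:
  assumes I: "is_cube I" and f: "f \<in> borel_measurable lebesgue" and c: "0 < c"
    and le: "AE x in lebesgue. x \<in> I \<longrightarrow> f x \<le> ennreal c * g x"
  shows "nn_avg I f \<le> ennreal c * nn_avg I g"
proof -
  have c1: "ennreal c * ennreal (1 / c) = 1" "ennreal (1 / c) * ennreal c = 1"
    using c by (simp_all add: ennreal_mult[symmetric])
  have "nn_avg I (\<lambda>x. ennreal (1 / c) * f x) \<le> nn_avg I g"
  proof (rule nn_avg_mono, use le in eventually_elim, safe)
    fix x assume "x \<in> I" "f x \<le> ennreal c * g x"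
    then have "ennreal (1 / c) * f x \<le> ennreal (1 / c) * (ennreal c * g x)"
      by (intro mult_left_mono) auto
    then show "ennreal (1 / c) * f x \<le> g x"
      by (simp add: mult.assoc[symmetric] c1)
  qed
  then have "ennreal c * (ennreal (1 / c) * nn_avg I f) \<le> ennreal c * nn_avg I g"
    unfolding nn_avg_cmult[OF I f] by (intro mult_left_mono) auto
  then show ?thesis by (simp add: mult.assoc[symmetric] c1)
qed

lemma nn_avg_subset:
  assumes I: "is_cube I" and J: "is_cube J" and "I \<subseteq> J"
    and c: "measure lebesgue J \<le> c * measure lebesgue I"
  shows "nn_avg I f \<le> ennreal c * nn_avg J f"
proof -
  define a b where "a = measure lebesgue I" and "b = measure lebesgue J"
  have pos: "0 < a" "0 < b" using is_cube_lebesgue I J by (auto simp: a_def b_def)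
  have c0: "0 < c" using c pos by (smt (verit) a_def b_def mult_nonneg_nonneg zero_less_mult_pos2)
  define N where "N = (\<integral>\<^sup>+x\<in>J. f x \<partial>lebesgue)"
  have "(\<integral>\<^sup>+x\<in>I. f x \<partial>lebesgue) \<le> N"
    unfolding N_def using \<open>I \<subseteq> J\<close> by (intro nn_integral_mono) (auto split: split_indicator)
  then have "nn_avg I f \<le> N / ennreal a"
    unfolding nn_avg_def is_cube_lebesgue(3)[OF I] a_def by (rule divide_right_mono_ennreal)
  also have "\<dots> \<le> ennreal c * (N / ennreal b)"
  proof (cases N)
    case (real r)
    then have "0 \<le> r" by simp
    then have "b * r \<le> (a * c) * r"
      using c by (intro mult_right_mono) (simp_all add: a_def b_def mult.commute)
    then have "r / a \<le> c * (r / b)"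
      using pos by (simp add: field_simps)
    then show ?thesis
      using real pos c0 by (simp add: divide_ennreal ennreal_leI ennreal_mult[symmetric])
  qed (use pos c0 in \<open>simp add: ennreal_top_divide ennreal_mult_top\<close>)
  also have "\<dots> = ennreal c * nn_avg J f"
    unfolding nn_avg_def is_cube_lebesgue(3)[OF J] b_def N_def ..
  finally show ?thesis .
qed

text \<open>Young's inequality takes the place of Hoelder's, since only the finiteness of averages matters
  below, not their homogeneity.\<close>

lemma nn_avg_mult_le:
  assumes I: "is_cube I" and q: "1 < q" "1 < q'" "1 / q + 1 / q' = 1"
    and [measurable]: "f \<in> borel_measurable lebesgue" "g \<in> borel_measurable lebesgue"
    and f0: "\<And>x. 0 \<le> f x" and g0: "\<And>x. 0 \<le> g x"
    and f: "nn_avg I (\<lambda>x. ennreal (f x powr q)) \<le> ennreal a"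
    and g: "nn_avg I (\<lambda>x. ennreal (g x powr q')) \<le> ennreal b"
    and ab: "0 \<le> a" "0 \<le> b"
  shows "nn_avg I (\<lambda>x. ennreal (f x * g x)) \<le> ennreal (a + b)"
proof -
  have "f x * g x \<le> f x powr q + g x powr q'" for x
  proof -
    have "f x * g x \<le> f x powr q / q + g x powr q' / q'"
      by (rule Youngs_inequality) (use q f0 g0 in auto)
    also have "\<dots> \<le> f x powr q + g x powr q'"
      using q by (intro add_mono) (auto simp: divide_le_eq mult_le_cancel_left1)
    finally show ?thesis .
  qed
  then have "nn_avg I (\<lambda>x. ennreal (f x * g x)) \<le>
      nn_avg I (\<lambda>x. ennreal (f x powr q) + ennreal (g x powr q'))"
    by (intro nn_avg_mono) (auto simp: ennreal_leI simp flip: ennreal_plus)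
  also have "\<dots> \<le> ennreal a + ennreal b"
    by (subst nn_avg_add[OF I]) (use f g in \<open>auto intro: add_mono\<close>)
  finally show ?thesis using ab by simp
qed

lemma mat_avg_eq:
  fixes F :: "real^'d \<Rightarrow> complex^'n^'n"
  assumes "set_integrable lebesgue I F"
  shows "mat_avg I F = (LINT x:I|lebesgue. F x) /\<^sub>R measure lebesgue I"
proof -
  have T: "bounded_linear (\<lambda>A::complex^'n^'n. A $ i $ j)" for i j
    by (rule bounded_linear_compose[OF bounded_linear_vec_nth bounded_linear_vec_nth])
  have "(LINT x:I|lebesgue. F x $ i $ j) = (LINT x:I|lebesgue. F x) $ i $ j" for i j
    using integral_bounded_linear[OF T assms[unfolded set_integrable_def]]
    by (simp add: set_lebesgue_integral_def)
  then show ?thesis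
    by (simp add: mat_avg_def vec_eq_iff) (simp add: scaleR_conv_of_real divide_inverse mult.commute)
qed

lemma mat_avg_diff_const:
  fixes F :: "real^'d \<Rightarrow> complex^'n^'n"
  assumes I: "is_cube I" and F: "set_integrable lebesgue I F"
  shows "set_integrable lebesgue I (\<lambda>x. F x - A)" "mat_avg I (\<lambda>x. F x - A) = mat_avg I F - A"
proof -
  note cube = is_cube_lebesgue[OF I]
  have A: "set_integrable lebesgue I (\<lambda>x. A)"
    unfolding set_integrable_def using cube
    by (intro integrable_scaleR_left) (auto intro!: integrable_real_indicator)
  show D: "set_integrable lebesgue I (\<lambda>x. F x - A)"
    by (rule set_integral_diff(1)[OF F A])
  show "mat_avg I (\<lambda>x. F x - A) = mat_avg I F - A"
    unfolding mat_avg_eq[OF D] mat_avg_eq[OF F] set_integral_diff(2)[OF F A]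
    using cube set_integral_const[of I lebesgue A] by (simp add: scaleR_diff_right)
qed

text \<open>The triangle inequality for the integral, after moving the bounded linear map
  \<open>A \<mapsto> X ** A ** Y\<close> under it.\<close>

lemma norm_mat_avg_le:
  fixes F :: "real^'d \<Rightarrow> complex^'n^'n" and X Y :: "complex^'n^'n"
  assumes I: "is_cube I" and F: "set_integrable lebesgue I F"
  shows "ennreal (norm (X ** mat_avg I F ** Y)) \<le> nn_avg I (\<lambda>x. ennreal (norm (X ** F x ** Y)))"
proof -
  define T where "T A = X ** A ** Y" for A :: "complex^'n^'n"
  interpret bounded_bilinear "(**) :: complex^'n^'n \<Rightarrow> complex^'n^'n \<Rightarrow> complex^'n^'n"
    by (rule bounded_bilinear_matrix_mult)
  have T: "bounded_linear T"
    unfolding T_def using bounded_linear_compose[OF bounded_linear_left[of Y] bounded_linear_right[of X]] .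
  define m where "m = measure lebesgue I"
  have m: "0 < m" "emeasure lebesgue I = ennreal m" using is_cube_lebesgue[OF I] by (auto simp: m_def)
  have TF: "integrable lebesgue (\<lambda>x. T (indicator I x *\<^sub>R F x))"
    using integrable_bounded_linear[OF T] F unfolding set_integrable_def by blast
  have "T (mat_avg I F) = (LINT x|lebesgue. T (indicator I x *\<^sub>R F x)) /\<^sub>R m"
    unfolding mat_avg_eq[OF F] m_def[symmetric]
    using integral_bounded_linear[OF T F[unfolded set_integrable_def]]
    by (simp add: set_lebesgue_integral_def linear_cmul[OF bounded_linear.linear[OF T]])
  then have "ennreal (norm (T (mat_avg I F))) = ennreal (norm (LINT x|lebesgue. T (indicator I x *\<^sub>R F x))) / ennreal m"
    using m by (simp add: divide_ennreal divide_inverse mult.commute)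
  also have "\<dots> \<le> (\<integral>\<^sup>+x. ennreal (norm (T (indicator I x *\<^sub>R F x))) \<partial>lebesgue) / ennreal m"
    by (intro divide_right_mono_ennreal integral_norm_bound_ennreal TF)
  also have "\<dots> = nn_avg I (\<lambda>x. ennreal (norm (T (F x))))"
    unfolding nn_avg_def m
    by (intro arg_cong2[where f="(/)"] nn_integral_cong)
      (auto simp: linear_0[OF bounded_linear.linear[OF T]] split: split_indicator)
  finally show ?thesis by (simp add: T_def)
qed

section \<open>Reducing operators of matrices\<close>

lemma borel_measurable_matrix_mult [measurable (raw)]:
  fixes F G :: "'a \<Rightarrow> complex^'n^'n"
  assumes "F \<in> borel_measurable M" "G \<in> borel_measurable M"
  shows "(\<lambda>x. F x ** G x) \<in> borel_measurable M"
proof -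
  have "continuous_on UNIV (\<lambda>z :: (complex^'n^'n) \<times> (complex^'n^'n). fst z ** snd z)"
    by (intro bounded_bilinear.continuous_on[OF bounded_bilinear_matrix_mult] continuous_intros)
  from borel_measurable_continuous_on[OF this borel_measurable_Pair[OF assms]] show ?thesis by simp
qed

lemma borel_measurable_matrix_vector_mult [measurable (raw)]:
  fixes F :: "'a \<Rightarrow> complex^'n^'n"
  assumes "F \<in> borel_measurable M"
  shows "(\<lambda>x. F x *v e) \<in> borel_measurable M"
proof -
  have "continuous_on UNIV (\<lambda>A :: complex^'n^'n. A *v e)"
    unfolding matrix_vector_mult_def by (intro continuous_intros)
  from borel_measurable_continuous_on[OF this assms] show ?thesis .
qed

lemma sum_powr_le:
  fixes a :: "'n::finite \<Rightarrow> real"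
  assumes a: "\<And>j. 0 \<le> a j" and q: "0 \<le> q"
  shows "(\<Sum>j\<in>UNIV. a j) powr q \<le> real CARD('n) powr q * (\<Sum>j\<in>UNIV. a j powr q)"
proof -
  have "Max (range a) \<in> range a" by (rule Max_in) auto
  then obtain k where k: "Max (range a) = a k" by blast
  have "a j \<le> a k" for j unfolding k[symmetric] by (rule Max_ge) auto
  then have "(\<Sum>j\<in>UNIV. a j) \<le> (\<Sum>j\<in>(UNIV::'n set). a k)" by (rule sum_mono)
  then have "(\<Sum>j\<in>UNIV. a j) powr q \<le> (real CARD('n) * a k) powr q"
    using q a by (intro powr_mono2) (simp_all add: sum_nonneg)
  also have "\<dots> = real CARD('n) powr q * a k powr q"
    using a by (simp add: powr_mult)
  also have "\<dots> \<le> real CARD('n) powr q * (\<Sum>j\<in>UNIV. a j powr q)"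
    by (intro mult_left_mono member_le_sum) auto
  finally show ?thesis .
qed

lemma norm_powr_le_sum_columns:
  fixes A :: "complex^'n^'n"
  assumes q: "0 \<le> q"
  shows "norm A powr q \<le> real CARD('n) powr q * (\<Sum>j\<in>UNIV. norm (A *v axis j 1) powr q)"
proof -
  have "norm A powr q \<le> (\<Sum>j\<in>UNIV. norm (A *v axis j 1)) powr q"
    by (intro powr_mono2 norm_le_sum_columns q) auto
  also have "\<dots> \<le> real CARD('n) powr q * (\<Sum>j\<in>UNIV. norm (A *v axis j 1) powr q)"
    by (rule sum_powr_le) (use q in auto)
  finally show ?thesis .
qed

lemma reducing_op_vector:
  fixes A :: "complex^'n^'n"
  assumes red: "reducing_op q s W I A" and q: "0 < q"
  shows "nn_avg I (\<lambda>x. ennreal (norm (mat_powr (W x) s *v e) powr q)) \<le> ennreal (norm (A *v e) powr q)"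
    and "ennreal (norm (A *v e) powr q) \<le>
      ennreal (sqrt (real CARD('n)) powr q) * nn_avg I (\<lambda>x. ennreal (norm (mat_powr (W x) s *v e) powr q))"
proof -
  define R where "R = nn_avg I (\<lambda>x. ennreal (norm (mat_powr (W x) s *v e) powr q))"
  have bounds: "ennpowr R (1/q) \<le> ennreal (norm (A *v e))"
    "ennreal (norm (A *v e)) \<le> ennreal (sqrt (real CARD('n))) * ennpowr R (1/q)"
    using red unfolding reducing_op_def avg_norm_def R_def by auto
  obtain r where r: "R = ennreal r" "0 \<le> r"
    using bounds(1) by (cases R) (auto simp: ennpowr_def top_unique)
  have b: "r powr (1/q) \<le> norm (A *v e)" "norm (A *v e) \<le> sqrt (real CARD('n)) * r powr (1/q)"
    using bounds r by (simp_all add: ennpowr_def flip: ennreal_mult')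
  have rq: "(r powr (1/q)) powr q = r" using r q by (simp add: powr_powr)
  have "r \<le> norm (A *v e) powr q"
    using powr_mono2[OF less_imp_le[OF q] _ b(1)] rq by simp
  then show "R \<le> ennreal (norm (A *v e) powr q)"
    by (simp add: r ennreal_leI)
  have "norm (A *v e) powr q \<le> sqrt (real CARD('n)) powr q * r"
    using powr_mono2[OF less_imp_le[OF q] _ b(2)] rq by (simp add: powr_mult)
  then show "ennreal (norm (A *v e) powr q) \<le> ennreal (sqrt (real CARD('n)) powr q) * R"
    using r by (simp add: ennreal_leI flip: ennreal_mult')
qed

text \<open>The factor \<open>n powr q\<close> comes from the power of a sum of \<open>n\<close> column norms, the factor \<open>n\<close> from
  the number of columns; the last factor covers both constants, \<open>1\<close> and \<open>sqrt n\<close>, in the definition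
  of a reducing operator, raised to the power \<open>q\<close>.\<close>

definition reducing_const :: "real \<Rightarrow> real \<Rightarrow> real" where
  "reducing_const n q = n powr q * n * (1 + sqrt n powr q)"

lemma reducing_const_pos: "0 < n \<Longrightarrow> 0 < reducing_const n q"
  unfolding reducing_const_def by (intro mult_pos_pos add_pos_nonneg) auto

text \<open>A reducing operator replaces the weight on average not only for vectors but, column by column,
  for the norm of a product with an arbitrary matrix \<open>X\<close>. Both inequalities will be applied with
  \<open>X\<close> built from other reducing operators.\<close>

lemma reducing_op_matrix:
  fixes A X :: "complex^'n^'n" and W :: "real^'d \<Rightarrow> complex^'n^'n"
  assumes red: "reducing_op q s W I A" and q: "0 < q" and I: "is_cube I"
    and [measurable]: "(\<lambda>x. mat_powr (W x) s) \<in> borel_measurable lebesgue"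
  shows "nn_avg I (\<lambda>x. ennreal (norm (mat_powr (W x) s ** X) powr q)) \<le>
      ennreal (reducing_const (real CARD('n)) q * norm (A ** X) powr q)"
    and "ennreal (norm (A ** X) powr q) \<le>
      ennreal (reducing_const (real CARD('n)) q) * nn_avg I (\<lambda>x. ennreal (norm (mat_powr (W x) s ** X) powr q))"
proof -
  let ?n = "real CARD('n)" and ?P = "\<lambda>x. mat_powr (W x) s"
  let ?e = "\<lambda>j::'n. X *v axis j 1"
  define S where "S = sqrt ?n powr q"
  have n: "0 < ?n" and S: "0 < S" by (simp_all add: S_def)
  have K: "?n powr q * ?n \<le> reducing_const (real CARD('n)) q" "?n powr q * ?n * S \<le> reducing_const (real CARD('n)) q"
    unfolding reducing_const_def S_def by (simp_all add: distrib_left)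
  have "nn_avg I (\<lambda>x. ennreal (norm (?P x ** X) powr q)) \<le>
      nn_avg I (\<lambda>x. ennreal (?n powr q) * (\<Sum>j\<in>UNIV. ennreal (norm (?P x *v ?e j) powr q)))"
  proof (intro nn_avg_mono AE_I2 impI)
    fix x
    show "ennreal (norm (?P x ** X) powr q) \<le>
        ennreal (?n powr q) * (\<Sum>j\<in>UNIV. ennreal (norm (?P x *v ?e j) powr q))"
      using norm_powr_le_sum_columns[of q "?P x ** X"] q
      by (simp add: ennreal_leI sum_nonneg matrix_mult_column flip: ennreal_mult')
  qed
  also have "\<dots> = ennreal (?n powr q) * (\<Sum>j\<in>UNIV. nn_avg I (\<lambda>x. ennreal (norm (?P x *v ?e j) powr q)))"
    by (simp add: nn_avg_cmult[OF I] nn_avg_sum[OF I] del: sum_ennreal)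
  also have "\<dots> \<le> ennreal (?n powr q) * (\<Sum>j\<in>(UNIV::'n set). ennreal (norm (A ** X) powr q))"
  proof (intro mult_left_mono sum_mono)
    fix j
    have "norm (A *v ?e j) powr q \<le> norm (A ** X) powr q"
      using q norm_column_le[of "A ** X" j] by (intro powr_mono2) (simp_all add: matrix_mult_column)
    then show "nn_avg I (\<lambda>x. ennreal (norm (?P x *v ?e j) powr q)) \<le> ennreal (norm (A ** X) powr q)"
      using reducing_op_vector(1)[OF red q, of "?e j"] by (meson ennreal_leI order_trans)
  qed simp
  also have "\<dots> = ennreal (?n powr q * ?n * norm (A ** X) powr q)"
    by (simp add: ennreal_of_nat_eq_real_of_nat mult.assoc flip: ennreal_mult')
  also have "\<dots> \<le> ennreal (reducing_const (real CARD('n)) q * norm (A ** X) powr q)"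
    by (intro ennreal_leI mult_right_mono K) auto
  finally show "nn_avg I (\<lambda>x. ennreal (norm (?P x ** X) powr q)) \<le>
      ennreal (reducing_const (real CARD('n)) q * norm (A ** X) powr q)" .
  define R where "R = nn_avg I (\<lambda>x. ennreal (norm (?P x ** X) powr q))"
  have "ennreal (norm (A ** X) powr q) \<le> ennreal (?n powr q * (\<Sum>j\<in>UNIV. norm (A *v ?e j) powr q))"
    using norm_powr_le_sum_columns[of q "A ** X"] q by (simp add: ennreal_leI matrix_mult_column)
  also have "\<dots> = ennreal (?n powr q) * (\<Sum>j\<in>UNIV. ennreal (norm (A *v ?e j) powr q))"
    by (simp add: ennreal_mult' sum_nonneg)
  also have "\<dots> \<le> ennreal (?n powr q) * (\<Sum>j\<in>(UNIV::'n set). ennreal S * R)"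
  proof (intro mult_left_mono sum_mono)
    fix j
    have "nn_avg I (\<lambda>x. ennreal (norm (?P x *v ?e j) powr q)) \<le> R"
      unfolding R_def
      using q norm_column_le[of "_ ** X" j]
      by (intro nn_avg_mono AE_I2 impI ennreal_leI powr_mono2) (simp_all add: matrix_mult_column)
    then show "ennreal (norm (A *v ?e j) powr q) \<le> ennreal S * R"
      using reducing_op_vector(2)[OF red q, of "?e j"] unfolding S_def
      by (meson mult_left_mono order_trans zero_le)
  qed simp
  also have "\<dots> = ennreal (?n powr q * ?n * S) * R"
    using S by (simp add: ennreal_of_nat_eq_real_of_nat mult.assoc ennreal_mult)
  also have "\<dots> \<le> ennreal (reducing_const (real CARD('n)) q) * R"
    by (intro mult_right_mono ennreal_leI K) auto
  finally show "ennreal (norm (A ** X) powr q) \<le> ennreal (reducing_const (real CARD('n)) q) * R" .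
qed

text \<open>The \<open>A\<^sub>p\<close> condition in terms of reducing operators. Replacing the weights by reducing operators
  in \<open>V ** V'\<close> one at a time, and using that the factors are Hermitian to exchange their order,
  bounds the \<open>p\<close>-th power of its norm first by an average of \<open>norm (P x ** V') powr p\<close>, where
  \<open>P\<close> is the power \<open>1/p\<close> of the weight, and then by the
  double average in the definition of the \<open>A\<^sub>p\<close> constant. Unlike that definition, the bound on
  \<open>V ** V'\<close> is symmetric in the two weights, so that it serves the dual BMO condition as well.\<close>

lemma Ap_reducing_bound:
  fixes W :: "real^'d \<Rightarrow> complex^'n^'n"
  assumes p: "1 < p" and W: "Ap_weight p W"
  obtains C where "0 \<le> C" "\<And>I V V'. is_cube I \<Longrightarrow> reducing_op p (1/p) W I V \<Longrightarrow>
      reducing_op (conj_exp p) (-(1/p)) W I V' \<Longrightarrow> norm (V ** V') \<le> C"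
proof -
  let ?n = "real CARD('n)"
  define q where "q = conj_exp p"
  define P Q where "P x = mat_powr (W x) (1/p)" and "Q x = mat_powr (W x) (-(1/p))" for x
  have q: "0 < q" using p by (simp add: q_def conj_exp_def)
  have pd: "AE x in lebesgue. pos_def (W x)" using W by (simp add: Ap_weight_def)
  have meas: "(\<lambda>x. mat_powr (W x) s) \<in> borel_measurable lebesgue" for s
    using W by (intro measurable_mat_powr) (auto simp: Ap_weight_def)
  have [measurable]: "P \<in> borel_measurable lebesgue" "Q \<in> borel_measurable lebesgue"
    unfolding P_def Q_def by (rule meas)+
  \<comment> \<open>\<open>c\<close> and \<open>c'\<close> collect the losses in the inner and in the outer average\<close>
  define c where "c = reducing_const (real CARD('n)) q * ?n powr q"
  have c: "0 < c" using reducing_const_pos[of "real CARD('n)" q] by (simp add: c_def)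
  define h where "h I x = nn_avg I (\<lambda>t. ennreal (op_norm (P x ** Q t) powr q))" for I :: "(real^'d) set" and x
  define c' where "c' = c powr (p / q)"
  have c': "0 < c'" using c by (simp add: c'_def)
  define a where "a = enn2real (Ap_const p W)"
  have a: "Ap_const p W = ennreal a" "0 \<le> a"
    using W by (simp_all add: a_def Ap_weight_def)
  define C where "C = (reducing_const (real CARD('n)) p * (c' * a)) powr (1/p)"
  have "norm (V ** V') \<le> C" if I: "is_cube I" and V: "reducing_op p (1/p) W I V"
    and V': "reducing_op q (-(1/p)) W I V'" for I V V'
  proof -
    have herm: "conj_transpose V' = V'" using V' by (simp add: reducing_op_def pos_def_def)
    have flip: "norm (V' ** P x) = norm (P x ** V')" "norm (Q t ** P x) = norm (P x ** Q t)"
      if "pos_def (W x)" "pos_def (W t)" for x t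
      using that norm_conj_transpose[of "V' ** P x"] norm_conj_transpose[of "Q t ** P x"] herm
      unfolding conj_transpose_mult by (simp_all add: P_def Q_def conj_transpose_mat_powr)
    have inner: "ennreal (norm (P x ** V') powr q) \<le> ennreal c * h I x" if x: "pos_def (W x)" for x
    proof -
      have "nn_avg I (\<lambda>t. ennreal (norm (Q t ** P x) powr q)) \<le> ennreal (?n powr q) * h I x"
        unfolding h_def
      proof (rule nn_avg_le_cmult[OF I])
        show "AE t in lebesgue. t \<in> I \<longrightarrow> ennreal (norm (Q t ** P x) powr q) \<le>
            ennreal (?n powr q) * ennreal (op_norm (P x ** Q t) powr q)"
          using pd
        proof eventually_elim
          case (elim t)
          have "norm (Q t ** P x) powr q \<le> (?n * op_norm (P x ** Q t)) powr q"
            using norm_le_op_norm[of "P x ** Q t"] q flip(2)[OF x elim]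
            by (intro powr_mono2) simp_all
          then show ?case
            by (simp add: powr_mult op_norm_nonneg ennreal_leI flip: ennreal_mult')
        qed
      qed simp_all
      then have "ennreal (reducing_const (real CARD('n)) q) * nn_avg I (\<lambda>t. ennreal (norm (Q t ** P x) powr q)) \<le>
          ennreal (reducing_const (real CARD('n)) q) * (ennreal (?n powr q) * h I x)"
        by (intro mult_left_mono) auto
      also have "\<dots> = ennreal c * h I x"
        using reducing_const_pos[of "real CARD('n)" q]
        by (simp add: c_def ennreal_mult mult.assoc less_imp_le)
      finally have "ennreal (norm (V' ** P x) powr q) \<le> ennreal c * h I x"
        using reducing_op_matrix(2)[OF V' q I meas, of "P x"] by (simp add: Q_def)
      then show ?thesis using flip(1)[OF x x] by simp
    qed
    have outer: "ennreal (norm (P x ** V') powr p) \<le> ennreal c' * ennpowr (h I x) (p / q)"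
      if x: "pos_def (W x)" for x
    proof (cases "h I x")
      case (real r)
      have "norm (P x ** V') powr q \<le> c * r"
        using inner[OF x] real c by (simp flip: ennreal_mult')
      then have "(norm (P x ** V') powr q) powr (p / q) \<le> (c * r) powr (p / q)"
        using p q by (intro powr_mono2) auto
      then have "norm (P x ** V') powr p \<le> c' * r powr (p / q)"
        using q c real by (simp add: powr_powr c'_def powr_mult)
      then show ?thesis
        using real c' by (simp add: ennpowr_def ennreal_leI flip: ennreal_mult')
    qed (use c' in \<open>simp add: ennpowr_def ennreal_mult_top\<close>)
    have "nn_avg I (\<lambda>x. ennreal (norm (P x ** V') powr p)) \<le>
        ennreal c' * nn_avg I (\<lambda>x. ennpowr (h I x) (p / q))"
    proof (rule nn_avg_le_cmult[OF I _ c'])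
      show "AE x in lebesgue. x \<in> I \<longrightarrow>
          ennreal (norm (P x ** V') powr p) \<le> ennreal c' * ennpowr (h I x) (p / q)"
        using pd by eventually_elim (simp add: outer)
    qed simp
    also have "\<dots> \<le> ennreal c' * ennreal a"
      unfolding a(1)[symmetric] Ap_const_def h_def P_def Q_def q_def
      using I by (intro mult_left_mono SUP_upper2[of I]) auto
    finally have "ennreal (reducing_const (real CARD('n)) p) * nn_avg I (\<lambda>x. ennreal (norm (P x ** V') powr p)) \<le>
        ennreal (reducing_const (real CARD('n)) p) * (ennreal c' * ennreal a)"
      by (intro mult_left_mono) auto
    then have "ennreal (norm (V ** V') powr p) \<le> ennreal (reducing_const (real CARD('n)) p * (c' * a))"
      using reducing_op_matrix(2)[OF V _ I meas, of V'] p c' a reducing_const_pos[of "real CARD('n)" p]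
      by (simp add: P_def ennreal_mult less_imp_le)
    then have "norm (V ** V') powr p \<le> reducing_const (real CARD('n)) p * (c' * a)"
      using c' a reducing_const_pos[of "real CARD('n)" p] by (simp add: less_imp_le)
    then have "(norm (V ** V') powr p) powr (1/p) \<le> C"
      unfolding C_def using p by (intro powr_mono2) auto
    then show ?thesis using p by (simp add: powr_powr)
  qed
  moreover have "0 \<le> C" by (simp add: C_def)
  ultimately show thesis using that unfolding q_def by blast
qed

section \<open>Oscillation over a cube and over a larger cube\<close>

lemma locally_integrable_cube:
  assumes "locally_integrable F" "is_cube I"
  shows "set_integrable lebesgue I F"
proof -
  obtain a l where "I \<subseteq> cbox a (\<chi> i. a $ i + l)"
    using is_cube_between_boxes[OF assms(2)] by metis
  then show ?thesis
    using assms is_cube_lebesgue(1)[OF assms(2)]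
    by (meson compact_cbox locally_integrable_def set_integrable_subset)
qed

lemma locally_integrable_measurable:
  fixes F :: "real^'d \<Rightarrow> complex^'n^'n"
  assumes "locally_integrable F"
  shows "F \<in> borel_measurable lebesgue"
proof (rule borel_measurable_LIMSEQ_metric)
  show "(\<lambda>x. indicator (cball 0 (real k)) x *\<^sub>R F x) \<in> borel_measurable lebesgue" for k
    using assms unfolding locally_integrable_def set_integrable_def by (blast intro: borel_measurable_integrable compact_cball)
  show "(\<lambda>k. indicator (cball 0 (real k)) x *\<^sub>R F x) \<longlonglongrightarrow> F x" for x
  proof (rule tendsto_eventually)
    obtain N :: nat where "norm x \<le> real N" using real_arch_simple by blast
    then show "\<forall>\<^sub>F k in sequentially. indicator (cball 0 (real k)) x *\<^sub>R F x = F x"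
      unfolding eventually_sequentially by (intro exI[of _ N]) (auto simp: indicator_def)
  qed
qed

text \<open>The setting for both BMO conditions: \<open>P\<close> and \<open>Q\<close> stand for the powers \<open>1/p\<close> and \<open>-1/p\<close> of the
  weight, or the other way round, \<open>A\<close> and \<open>A'\<close> for their reducing operators. The bound
  \<open>product\<close> is the \<open>A\<^sub>p\<close> condition.\<close>

locale dual_weights =
  fixes P Q :: "real^'d \<Rightarrow> complex^'n^'n" and q q' K C :: real
    and A A' :: "(real^'d) set \<Rightarrow> complex^'n^'n"
  assumes P_measurable [measurable]: "P \<in> borel_measurable lebesgue"
    and Q_measurable [measurable]: "Q \<in> borel_measurable lebesgue"
    and QP: "AE x in lebesgue. Q x ** P x = mat 1"
    and exponents: "1 < q" "1 < q'" "1 / q + 1 / q' = 1"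
    and constants: "0 < K" "0 \<le> C"
    and inverse: "is_cube I \<Longrightarrow> A I ** matrix_inv (A I) = mat 1"
      "is_cube I \<Longrightarrow> matrix_inv (A I) ** A I = mat 1"
      "is_cube I \<Longrightarrow> A' I ** matrix_inv (A' I) = mat 1"
    and upper: "is_cube I \<Longrightarrow> nn_avg I (\<lambda>x. ennreal (norm (P x ** (X :: complex^'n^'n)) powr q)) \<le>
      ennreal (K * norm (A I ** X) powr q)"
    and upper_dual: "is_cube I \<Longrightarrow> nn_avg I (\<lambda>x. ennreal (norm (matrix_inv (A' I) ** Q x) powr q')) \<le> ennreal K"
    and product: "is_cube I \<Longrightarrow> norm (A I ** A' I) \<le> C"
begin

abbreviation oscillation :: "(real^'d) set \<Rightarrow> (real^'d \<Rightarrow> complex^'n^'n) \<Rightarrow> ennreal" where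
  "oscillation I F \<equiv> nn_avg I (\<lambda>x. ennreal (norm (P x ** (F x - mat_avg I F) ** matrix_inv (A I)) powr q))"

text \<open>Up to a constant, \<open>A J\<close> is dominated by the inverse of \<open>A' J\<close>. The inverse is the convenient one:
  a factor \<open>Q x\<close> can be inserted next to it, and its product with \<open>Q\<close> is bounded on average.\<close>

lemma product_dual_inverse:
  fixes X :: "complex^'n^'n"
  assumes J: "is_cube J"
  shows "norm (A J ** X) \<le> C * norm (matrix_inv (A' J) ** X)"
proof -
  have "A J ** X = (A J ** A' J) ** (matrix_inv (A' J) ** X)"
    using inverse(3)[OF J] by (metis matrix_mul_assoc matrix_mul_rid)
  then have "norm (A J ** X) \<le> norm (A J ** A' J) * norm (matrix_inv (A' J) ** X)"
    by (simp add: norm_matrix_mult_le)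
  also have "\<dots> \<le> C * norm (matrix_inv (A' J) ** X)"
    by (intro mult_right_mono product J) auto
  finally show ?thesis .
qed

lemma insert_QP:
  fixes X Y :: "complex^'n^'n"
  assumes "Q x ** P x = mat 1"
  shows "norm (X ** Y) \<le> norm (X ** Q x) * norm (P x ** Y)"
proof -
  have "X ** Y = (X ** Q x) ** (P x ** Y)"
    using assms by (metis matrix_mul_assoc matrix_mul_rid)
  then show ?thesis by (simp add: norm_matrix_mult_le)
qed

definition inverse_bound :: real where
  "inverse_bound = K * norm (mat 1 :: complex^'n^'n) powr q"

lemma inverse_bound_nonneg: "0 \<le> inverse_bound"
  using constants by (simp add: inverse_bound_def)

lemma upper_inverse:
  assumes I: "is_cube I"
  shows "nn_avg I (\<lambda>x. ennreal (norm (P x ** matrix_inv (A I)) powr q)) \<le> ennreal inverse_bound"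
  using upper[OF I, of "matrix_inv (A I)"] by (simp add: inverse[OF I] inverse_bound_def)

text \<open>Doubling: on the smaller cube the product of the two inverses is bounded by inserting
  \<open>Q x ** P x = mat 1\<close>, averaging over \<open>I\<close> and using Young's inequality. Only the average of the
  \<open>Q\<close> factor has to be compared with one over \<open>J\<close>.\<close>

lemma reducing_doubling:
  assumes I: "is_cube I" and J: "is_cube J" and IJ: "I \<subseteq> J"
    and c: "measure lebesgue J \<le> c * measure lebesgue I" and c0: "0 \<le> c"
  shows "norm (A J ** matrix_inv (A I)) \<le> C * (c * K + inverse_bound)"
proof -
  let ?X = "matrix_inv (A' J)" and ?Y = "matrix_inv (A I)"
  have dual: "nn_avg I (\<lambda>x. ennreal (norm (?X ** Q x) powr q')) \<le> ennreal (c * K)"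
  proof -
    have "nn_avg I (\<lambda>x. ennreal (norm (?X ** Q x) powr q')) \<le>
        ennreal c * nn_avg J (\<lambda>x. ennreal (norm (?X ** Q x) powr q'))"
      by (rule nn_avg_subset[OF I J IJ c])
    also have "\<dots> \<le> ennreal c * ennreal K"
      by (intro mult_left_mono upper_dual J) auto
    finally show ?thesis using c0 constants by (simp add: ennreal_mult)
  qed
  have "ennreal (norm (?X ** ?Y)) = nn_avg I (\<lambda>x. ennreal (norm (?X ** ?Y)))"
    by (rule nn_avg_const[OF I, symmetric])
  also have "\<dots> \<le> nn_avg I (\<lambda>x. ennreal (norm (?X ** Q x) * norm (P x ** ?Y)))"
    by (rule nn_avg_mono, use QP in eventually_elim) (auto intro!: ennreal_leI insert_QP)
  also have "\<dots> \<le> ennreal (c * K + inverse_bound)"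
    by (rule nn_avg_mult_le[OF I exponents(2,1) _ _ _ _ _ dual upper_inverse[OF I]])
      (use exponents constants c0 inverse_bound_nonneg in \<open>simp_all add: add.commute\<close>)
  finally have "norm (?X ** ?Y) \<le> c * K + inverse_bound"
    by (subst (asm) ennreal_le_iff) (use c0 constants inverse_bound_nonneg in simp_all)
  then show ?thesis
    using product_dual_inverse[OF J, of ?Y] constants by (meson mult_left_mono order_trans)
qed

text \<open>Write \<open>G = F - m\<^sub>J F\<close>, so that \<open>F - m\<^sub>I F = G - m\<^sub>I G\<close>. The part with \<open>G\<close> is an average over \<open>J\<close>
  after doubling has exchanged \<open>A I\<close> for \<open>A J\<close>. In the part with the constant matrix \<open>M = m\<^sub>I G\<close>
  the weight \<open>P\<close> averages to \<open>A I\<close>, which is dominated by the inverse of \<open>A' I\<close>; then \<open>M\<close> is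
  written as an average again, and inserting \<open>Q x ** P x\<close> separates a bounded factor from the
  part with \<open>G\<close>.\<close>

lemma oscillation_subcube:
  assumes c0: "0 \<le> c" and b0: "0 \<le> b"
  obtains B where "\<And>I J F. is_cube I \<Longrightarrow> is_cube J \<Longrightarrow> I \<subseteq> J \<Longrightarrow>
    measure lebesgue J \<le> c * measure lebesgue I \<Longrightarrow> locally_integrable F \<Longrightarrow>
    oscillation J F \<le> ennreal b \<Longrightarrow> oscillation I F \<le> ennreal B"
proof -
  \<comment> \<open>\<open>D\<close> bounds \<open>A J ** matrix_inv (A I)\<close>; \<open>b1\<close> and \<open>b2\<close> bound the parts with \<open>G\<close> and with \<open>M\<close>\<close>
  define D where "D = C * (c * K + inverse_bound)"
  define b1 where "b1 = D powr q * (c * b)"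
  define b2 where "b2 = K * (C * (K + b1)) powr q"
  have D: "0 \<le> D" using constants c0 inverse_bound_nonneg by (simp add: D_def)
  have b1: "0 \<le> b1" and b2: "0 \<le> b2" using c0 b0 constants by (simp_all add: b1_def b2_def)
  have q0: "0 \<le> q" using exponents by simp
  have "oscillation I F \<le> ennreal (2 powr q * (b1 + b2))"
    if I: "is_cube I" and J: "is_cube J" and IJ: "I \<subseteq> J"
      and c: "measure lebesgue J \<le> c * measure lebesgue I" and F: "locally_integrable F"
      and osc: "oscillation J F \<le> ennreal b" for I J F
  proof -
    define G where "G x = F x - mat_avg J F" for x
    define M where "M = mat_avg I G"
    let ?Y = "matrix_inv (A I)" and ?X = "matrix_inv (A' I)"
    note FI = locally_integrable_cube[OF F I]
    have [measurable]: "F \<in> borel_measurable lebesgue" by (rule locally_integrable_measurable[OF F])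
    have G [measurable]: "G \<in> borel_measurable lebesgue" unfolding G_def by simp
    have GI: "set_integrable lebesgue I G"
      unfolding G_def by (rule mat_avg_diff_const(1)[OF I FI])
    have FM: "F x - mat_avg I F = G x - M" for x
      unfolding M_def G_def mat_avg_diff_const(2)[OF I FI] by simp

    have first: "nn_avg I (\<lambda>x. ennreal (norm (P x ** G x ** ?Y) powr q)) \<le> ennreal b1"
    proof -
      have "nn_avg I (\<lambda>x. ennreal (norm (P x ** G x ** ?Y) powr q)) \<le>
          nn_avg I (\<lambda>x. ennreal (D powr q) * ennreal (norm (P x ** G x ** matrix_inv (A J)) powr q))"
      proof (intro nn_avg_mono AE_I2 impI)
        fix x
        have "P x ** G x ** ?Y = (P x ** G x ** matrix_inv (A J)) ** (A J ** ?Y)"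
          using inverse(2)[OF J] by (metis matrix_mul_assoc matrix_mul_rid)
        then have "norm (P x ** G x ** ?Y) \<le> norm (P x ** G x ** matrix_inv (A J)) * norm (A J ** ?Y)"
          by (simp add: norm_matrix_mult_le)
        also have "\<dots> \<le> norm (P x ** G x ** matrix_inv (A J)) * D"
          unfolding D_def by (intro mult_left_mono reducing_doubling[OF I J IJ c c0]) auto
        finally have "norm (P x ** G x ** ?Y) powr q \<le> (norm (P x ** G x ** matrix_inv (A J)) * D) powr q"
          by (intro powr_mono2 q0) auto
        then show "ennreal (norm (P x ** G x ** ?Y) powr q) \<le>
            ennreal (D powr q) * ennreal (norm (P x ** G x ** matrix_inv (A J)) powr q)"
          using D by (simp add: powr_mult mult.commute ennreal_leI flip: ennreal_mult')
      qed
      also have "\<dots> = ennreal (D powr q) * nn_avg I (\<lambda>x. ennreal (norm (P x ** G x ** matrix_inv (A J)) powr q))"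
        by (rule nn_avg_cmult[OF I]) simp
      also have "\<dots> \<le> ennreal (D powr q) * (ennreal c * oscillation J F)"
        unfolding G_def by (intro mult_left_mono nn_avg_subset[OF I J IJ c]) auto
      also have "\<dots> \<le> ennreal (D powr q) * (ennreal c * ennreal b)"
        by (intro mult_left_mono osc) auto
      also have "\<dots> = ennreal b1" using c0 b0 by (simp add: b1_def ennreal_mult)
      finally show ?thesis .
    qed

    have second: "nn_avg I (\<lambda>x. ennreal (norm (P x ** M ** ?Y) powr q)) \<le> ennreal b2"
    proof -
      have "ennreal (norm (?X ** M ** ?Y)) \<le> nn_avg I (\<lambda>x. ennreal (norm (?X ** G x ** ?Y)))"
        unfolding M_def by (rule norm_mat_avg_le[OF I GI])
      also have "\<dots> \<le> nn_avg I (\<lambda>x. ennreal (norm (?X ** Q x) * norm (P x ** G x ** ?Y)))"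
      proof (rule nn_avg_mono, use QP in eventually_elim, intro impI ennreal_leI)
        fix x assume "Q x ** P x = mat 1"
        from insert_QP[OF this, of ?X "G x ** ?Y"]
        show "norm (?X ** G x ** ?Y) \<le> norm (?X ** Q x) * norm (P x ** G x ** ?Y)"
          by (simp add: matrix_mul_assoc)
      qed
      also have "\<dots> \<le> ennreal (K + b1)"
        by (rule nn_avg_mult_le[OF I exponents(2,1) _ _ _ _ _ upper_dual[OF I] first])
          (use exponents constants b1 in \<open>simp_all add: add.commute\<close>)
      finally have "norm (?X ** (M ** ?Y)) \<le> K + b1"
        by (subst (asm) ennreal_le_iff) (use constants b1 in \<open>simp_all add: matrix_mul_assoc\<close>)
      then have "norm (A I ** (M ** ?Y)) \<le> C * (K + b1)"
        using product_dual_inverse[OF I, of "M ** ?Y"] constants by (meson mult_left_mono order_trans)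
      then have "K * norm (A I ** (M ** ?Y)) powr q \<le> b2"
        unfolding b2_def using constants by (intro mult_left_mono powr_mono2 q0) auto
      then show ?thesis
        using upper[OF I, of "M ** ?Y"] by (simp add: matrix_mul_assoc) (meson ennreal_leI order_trans)
    qed

    have "oscillation I F \<le> nn_avg I (\<lambda>x. ennreal (2 powr q) *
        (ennreal (norm (P x ** G x ** ?Y) powr q) + ennreal (norm (P x ** M ** ?Y) powr q)))"
    proof (intro nn_avg_mono AE_I2 impI)
      fix x
      let ?u = "norm (P x ** G x ** ?Y)" and ?v = "norm (P x ** M ** ?Y)"
      interpret bounded_bilinear "(**) :: complex^'n^'n \<Rightarrow> complex^'n^'n \<Rightarrow> complex^'n^'n"
        by (rule bounded_bilinear_matrix_mult)
      have "norm (P x ** (F x - mat_avg I F) ** ?Y) \<le> ?u + ?v"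
        unfolding FM diff_left diff_right by (rule norm_triangle_ineq4)
      also have "\<dots> \<le> 2 * max ?u ?v" by simp
      finally have "norm (P x ** (F x - mat_avg I F) ** ?Y) powr q \<le> (2 * max ?u ?v) powr q"
        by (intro powr_mono2 q0) auto
      also have "\<dots> = 2 powr q * max ?u ?v powr q" by (simp add: powr_mult)
      also have "\<dots> \<le> 2 powr q * (?u powr q + ?v powr q)"
        by (intro mult_left_mono) (auto simp: max_def)
      finally show "ennreal (norm (P x ** (F x - mat_avg I F) ** ?Y) powr q) \<le>
          ennreal (2 powr q) * (ennreal (?u powr q) + ennreal (?v powr q))"
        by (simp add: ennreal_leI flip: ennreal_mult' ennreal_plus)
    qed
    also have "\<dots> = ennreal (2 powr q) * (nn_avg I (\<lambda>x. ennreal (norm (P x ** G x ** ?Y) powr q)) +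
        nn_avg I (\<lambda>x. ennreal (norm (P x ** M ** ?Y) powr q)))"
      by (subst nn_avg_cmult[OF I], simp, subst nn_avg_add[OF I]) simp_all
    also have "\<dots> \<le> ennreal (2 powr q) * (ennreal b1 + ennreal b2)"
      by (intro mult_left_mono add_mono first second) auto
    also have "\<dots> = ennreal (2 powr q * (b1 + b2))"
      using b1 b2 by (simp add: ennreal_mult)
    finally show ?thesis .
  qed
  then show thesis using that by blast
qed

end

section \<open>Shifted dyadic grids\<close>

text \<open>At side length \<open>2 powi k\<close> the second one-dimensional grid is the first one moved by a third of the
  side. The alternating sign makes consecutive levels compatible, because
  \<open>2 * (1/3) = 1 - 1/3\<close>: the shift of level \<open>k + 1\<close> differs from that of level \<open>k\<close> by exactly one
  side of level \<open>k\<close>.\<close>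

definition grid_shift :: "bool \<Rightarrow> int \<Rightarrow> real" where
  "grid_shift b k = (if b then (if even k then 1 else -1) * 2 powi k / 3 else 0)"

definition grid_cube :: "('d::finite \<Rightarrow> bool) \<Rightarrow> int \<Rightarrow> ('d \<Rightarrow> int) \<Rightarrow> (real^'d) set" where
  "grid_cube \<beta> k m = half_open_cube (\<chi> i. 2 powi k * of_int (m i) + grid_shift (\<beta> i) k) (2 powi k)"

definition shifted_grid :: "('d::finite \<Rightarrow> bool) \<Rightarrow> (real^'d) set set" where
  "shifted_grid \<beta> = {grid_cube \<beta> k m | k m. True}"

lemma mem_grid_cube:
  "x \<in> grid_cube \<beta> k m \<longleftrightarrow>
    (\<forall>i. 2 powi k * of_int (m i) + grid_shift (\<beta> i) k \<le> x $ i \<and> x $ i < 2 powi k * (of_int (m i) + 1) + grid_shift (\<beta> i) k)"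
  by (simp add: grid_cube_def half_open_cube_def algebra_simps)

lemma grid_shift_step: "\<exists>z::int. grid_shift b (k + int n) = grid_shift b k + 2 powi k * z"
proof (induction n)
  case (Suc n)
  then obtain z :: int where z: "grid_shift b (k + int n) = grid_shift b k + 2 powi k * z" by blast
  let ?k = "k + int n"
  have step: "(2::real) powi (1 + ?k) = 2 * 2 powi ?k" by (simp add: power_int_add)
  have pow: "(2::real) powi ?k = 2 powi k * of_int (2 ^ n)" by (simp add: power_int_add)
  define s :: int where "s = (if even ?k then 1 else -1)"
  have "grid_shift b (1 + ?k) = grid_shift b ?k + 2 powi ?k * (if b then - s else 0)"
    unfolding grid_shift_def step s_def by (auto simp: field_simps)
  also have "\<dots> = grid_shift b k + 2 powi k * of_int (z + 2 ^ n * (if b then - s else 0))"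
    unfolding z pow by (simp add: algebra_simps)
  finally show ?case by (metis add.assoc add.commute of_nat_Suc)
qed (auto intro: exI[of _ 0])

text \<open>The endpoints of level \<open>k'\<close> are among those of level \<open>k\<close>, hence no cell of level \<open>k\<close> is cut by one
  of level \<open>k'\<close>.\<close>

lemma grid_cube_nested:
  assumes kk: "k \<le> k'" and x: "x \<in> grid_cube \<beta> k m" "x \<in> grid_cube \<beta> k' m'"
  shows "grid_cube \<beta> k m \<subseteq> grid_cube \<beta> k' m'"
proof
  fix y assume y: "y \<in> grid_cube \<beta> k m"
  define h :: real where "h = 2 powi k"
  have h: "0 < h" by (simp add: h_def)
  define n where "n = nat (k' - k)"
  have k': "k' = k + int n" using kk by (simp add: n_def)
  have pow: "(2::real) powi k' = h * of_int (2 ^ n)" by (simp add: k' h_def power_int_add)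
  show "y \<in> grid_cube \<beta> k' m'"
    unfolding mem_grid_cube
  proof
    fix i
    let ?o = "grid_shift (\<beta> i) k"
    obtain z :: int where z: "grid_shift (\<beta> i) k' = ?o + h * z"
      using grid_shift_step[of "\<beta> i" k n] unfolding k' h_def by blast
    define e :: int where "e = 2 ^ n * m' i + z"
    have left: "2 powi k' * of_int (m' i) + grid_shift (\<beta> i) k' = h * of_int e + ?o"
      unfolding pow z e_def by (simp add: algebra_simps)
    have right: "2 powi k' * (of_int (m' i) + 1) + grid_shift (\<beta> i) k' = h * (of_int e + 2 ^ n) + ?o"
      unfolding pow z e_def by (simp add: algebra_simps)
    have xi: "h * of_int (m i) + ?o \<le> x $ i" "x $ i < h * (of_int (m i) + 1) + ?o"
      "h * of_int e + ?o \<le> x $ i" "x $ i < h * (of_int e + 2 ^ n) + ?o"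
      using x(1)[unfolded mem_grid_cube, rule_format, of i]
        x(2)[unfolded mem_grid_cube, rule_format, of i, unfolded left right]
      by (simp_all add: h_def)
    have yi: "h * of_int (m i) + ?o \<le> y $ i" "y $ i < h * (of_int (m i) + 1) + ?o"
      using y unfolding mem_grid_cube h_def by auto
    have "h * of_int e < h * real_of_int (m i + 1)" using xi by simp
    then have "e < m i + 1" using h by (simp only: mult_less_cancel_left_pos of_int_less_iff)
    then have e1: "h * of_int e \<le> h * of_int (m i)" using h by simp
    have "h * of_int (m i) < h * real_of_int (e + 2 ^ n)" using xi by simp
    then have "m i < e + 2 ^ n" using h by (simp only: mult_less_cancel_left_pos of_int_less_iff)
    then have "m i + 1 \<le> e + 2 ^ n" by simp
    then have "real_of_int (m i + 1) \<le> real_of_int (e + 2 ^ n)" by (simp only: of_int_le_iff)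
    then have e2: "h * (of_int (m i) + 1) \<le> h * (of_int e + 2 ^ n)" using h by simp
    show "2 powi k' * of_int (m' i) + grid_shift (\<beta> i) k' \<le> y $ i \<and>
        y $ i < 2 powi k' * (of_int (m' i) + 1) + grid_shift (\<beta> i) k'"
      unfolding left right using yi e1 e2 by linarith
  qed
qed

lemma half_open_cube_between_boxes:
  "box a (\<chi> i. a $ i + l) \<subseteq> half_open_cube a l" "half_open_cube a l \<subseteq> cbox a (\<chi> i. a $ i + l)"
  by (auto simp: half_open_cube_def mem_box_cart less_imp_le)

lemma is_cube_half_open_cube: "0 < l \<Longrightarrow> is_cube (half_open_cube a l)"
  unfolding is_cube_def half_open_cube_def
  by (intro exI[of _ a] exI[of _ l] exI[of _ "\<lambda>i. {a $ i ..< a $ i + l}"]) auto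

lemma half_open_cube_length_unique:
  fixes a b :: "real^'d"
  assumes eq: "half_open_cube a l = half_open_cube b l'" and l: "0 < l" "0 < l'"
  shows "l = l'"
proof -
  have "ennreal (l ^ CARD('d)) = ennreal (l' ^ CARD('d))"
    using between_boxes_lebesgue(2)[OF l(1) half_open_cube_between_boxes, of a]
      between_boxes_lebesgue(2)[OF l(2) half_open_cube_between_boxes, of b] eq by metis
  then have "l ^ CARD('d) = l' ^ CARD('d)" using l by simp
  then show ?thesis using l by (intro power_eq_imp_eq_base[of l "CARD('d)" l']) auto
qed

text \<open>The side length of a half-open cube is determined by its measure, so the cubes of a given side
  are those of the corresponding level.\<close>

lemma shifted_grid_level:
  "{Q \<in> shifted_grid \<beta>. \<exists>a. Q = half_open_cube a (2 powi k)} = range (grid_cube \<beta> k)"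
proof -
  have "k' = k" if "grid_cube \<beta> k' m = half_open_cube a (2 powi k)" for k' m and a :: "real^'a"
  proof -
    have "(2::real) powi k' = 2 powi k"
      using that unfolding grid_cube_def by (rule half_open_cube_length_unique) auto
    then have "(2::real) powr real_of_int k' = 2 powr real_of_int k"
      by (simp add: powr_real_of_int')
    then have "real_of_int k' = real_of_int k" by (subst (asm) powr_inj) simp_all
    then show ?thesis by simp
  qed
  moreover have "\<exists>a. grid_cube \<beta> k m = half_open_cube a (2 powi k)" for m
    unfolding grid_cube_def by blast
  ultimately show ?thesis unfolding shifted_grid_def by blast
qed

lemma mem_grid_cube_floor:
  "x \<in> grid_cube \<beta> k (\<lambda>i. \<lfloor>(x $ i - grid_shift (\<beta> i) k) / 2 powi k\<rfloor>)"
  unfolding mem_grid_cube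
proof
  fix i
  define h :: real where "h = 2 powi k"
  have h: "0 < h" by (simp add: h_def)
  let ?y = "x $ i - grid_shift (\<beta> i) k"
  have "of_int \<lfloor>?y / h\<rfloor> \<le> ?y / h" "?y / h < of_int \<lfloor>?y / h\<rfloor> + 1" by linarith+
  then have "h * of_int \<lfloor>?y / h\<rfloor> \<le> ?y" "?y < h * (of_int \<lfloor>?y / h\<rfloor> + 1)"
    using h by (simp_all only: pos_le_divide_eq pos_divide_less_eq mult.commute)
  then show "2 powi k * of_int \<lfloor>?y / 2 powi k\<rfloor> + grid_shift (\<beta> i) k \<le> x $ i \<and>
      x $ i < 2 powi k * (of_int \<lfloor>?y / 2 powi k\<rfloor> + 1) + grid_shift (\<beta> i) k"
    unfolding h_def by linarith
qed

lemma dyadic_grid_shifted_grid: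
  fixes \<beta> :: "'d::finite \<Rightarrow> bool"
  shows "dyadic_grid (shifted_grid \<beta>)"
proof -
  have nested: "Q \<inter> R = {} \<or> Q \<subseteq> R \<or> R \<subseteq> Q" if QR: "Q \<in> shifted_grid \<beta>" "R \<in> shifted_grid \<beta>" for Q R
  proof -
    obtain k m k' m' where Q: "Q = grid_cube \<beta> k m" and R: "R = grid_cube \<beta> k' m'"
      using QR unfolding shifted_grid_def by blast
    show ?thesis
      using grid_cube_nested[of k k' _ \<beta> m m'] grid_cube_nested[of k' k _ \<beta> m' m]
      unfolding Q R by (cases "k \<le> k'") auto
  qed
  have "partition_on UNIV (range (grid_cube \<beta> k))" for k
  proof (rule partition_onI)
    show "\<Union> (range (grid_cube \<beta> k)) = UNIV" using mem_grid_cube_floor by blast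
    have "(\<chi> i. 2 powi k * of_int (m i) + grid_shift (\<beta> i) k) \<in> grid_cube \<beta> k m" for m
      unfolding mem_grid_cube by (simp add: distrib_left)
    then show "{} \<notin> range (grid_cube \<beta> k)" by blast
    show "disjnt p r" if "p \<in> range (grid_cube \<beta> k)" "r \<in> range (grid_cube \<beta> k)" "p \<noteq> r" for p r
      using that grid_cube_nested[OF order_refl[of k], of _ \<beta>] unfolding disjnt_def by blast
  qed
  moreover have "\<exists>a k. Q = half_open_cube a (2 powi k)" if "Q \<in> shifted_grid \<beta>" for Q
    using that unfolding shifted_grid_def grid_cube_def by blast
  ultimately show ?thesis
    unfolding dyadic_grid_def shifted_grid_level using nested by blast
qed

text \<open>Endpoints of the two one-dimensional grids are at least a third of the side apart. If the interval
  were contained in no cell, it would contain an endpoint of each grid, and these are too far apart.\<close>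

lemma interval_in_shifted_grid_cell:
  fixes a l :: real
  assumes l: "0 < l" "3 * l < 2 powi k"
  shows "\<exists>b (m::int). 2 powi k * of_int m + grid_shift b k \<le> a \<and> a + l < 2 powi k * (of_int m + 1) + grid_shift b k"
proof (rule ccontr)
  assume no: "\<not> ?thesis"
  define h :: real where "h = 2 powi k"
  have h: "0 < h" by (simp add: h_def)
  define m where "m b = \<lfloor>(a - grid_shift b k) / h\<rfloor>" for b
  define e where "e b = h * (of_int (m b) + 1) + grid_shift b k" for b
  have m: "h * of_int (m b) + grid_shift b k \<le> a" "a < e b" for b
  proof -
    have "of_int (m b) \<le> (a - grid_shift b k) / h" "(a - grid_shift b k) / h < of_int (m b) + 1"
      unfolding m_def by linarith+
    then show "h * of_int (m b) + grid_shift b k \<le> a" "a < e b"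
      using h by (simp_all add: field_simps e_def)
  qed
  have "e b \<le> a + l" for b
  proof (rule ccontr)
    assume "\<not> e b \<le> a + l"
    with m(1)[of b] no show False unfolding e_def h_def by (metis not_le)
  qed
  then have close: "\<bar>e True - e False\<bar> < l" using m(2) by (smt (verit))
  define s :: int where "s = (if even k then 1 else -1)"
  \<comment> \<open>a multiple of \<open>h\<close> by an integer that is not divisible by three\<close>
  have "3 * (e True - e False) = h * of_int (3 * (m True - m False) + s)"
    unfolding e_def grid_shift_def s_def h_def by (simp add: algebra_simps)
  moreover have "1 \<le> \<bar>3 * (m True - m False) + s\<bar>"
    unfolding s_def by presburger
  then have "1 \<le> \<bar>real_of_int (3 * (m True - m False) + s)\<bar>" by linarith
  then have "h \<le> \<bar>h * of_int (3 * (m True - m False) + s)\<bar>"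
    using h by (simp add: abs_mult)
  ultimately have "h \<le> \<bar>3 * (e True - e False)\<bar>" by simp
  then have "h \<le> 3 * \<bar>e True - e False\<bar>" by (simp only: abs_mult abs_numeral)
  also have "3 * \<bar>e True - e False\<bar> < 3 * l" using close by (rule mult_strict_left_mono) simp
  finally show False using l(2) by (simp add: h_def)
qed

text \<open>The grid is chosen separately in each coordinate, which is why two choices per coordinate, and
  thus \<open>2\<close> to the power of the dimension many grids, are enough.\<close>

lemma cube_in_shifted_grid:
  fixes I :: "(real^'d) set"
  assumes "is_cube I"
  obtains \<beta> J where "J \<in> shifted_grid \<beta>" "I \<subseteq> J" "is_cube J"
    "measure lebesgue J \<le> 6 ^ CARD('d) * measure lebesgue I"
proof -
  obtain a l where l: "0 < l" and I: "box a (\<chi> i. a $ i + l) \<subseteq> I" "I \<subseteq> cbox a (\<chi> i. a $ i + l)"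
    using is_cube_between_boxes[OF assms] by metis
  \<comment> \<open>the integer with \<open>3 l < 2 powi k \<le> 6 l\<close>\<close>
  define k where "k = \<lfloor>log 2 (6 * l)\<rfloor>"
  have "2 powr real_of_int k \<le> 2 powr log 2 (6 * l)" "2 powr log 2 (6 * l) < 2 powr (real_of_int k + 1)"
    unfolding k_def by simp_all
  then have k: "2 powi k \<le> 6 * l" "3 * l < 2 powi k"
    using l by (simp_all add: powr_add powr_real_of_int')
  have "\<exists>b (m::int). 2 powi k * of_int m + grid_shift b k \<le> a $ i \<and> a $ i + l < 2 powi k * (of_int m + 1) + grid_shift b k" for i
    by (rule interval_in_shifted_grid_cell[OF l k(2)])
  then obtain \<beta> m where bm: "\<And>i. 2 powi k * of_int (m i) + grid_shift (\<beta> i) k \<le> a $ i"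
    "\<And>i. a $ i + l < 2 powi k * (of_int (m i) + 1) + grid_shift (\<beta> i) k"
    by metis
  define J where "J = grid_cube \<beta> k m"
  have "cbox a (\<chi> i. a $ i + l) \<subseteq> J"
  proof
    fix x assume x: "x \<in> cbox a (\<chi> i. a $ i + l)"
    show "x \<in> J"
      unfolding J_def mem_grid_cube
    proof
      fix i
      have "a $ i \<le> x $ i" "x $ i \<le> a $ i + l" using x by (simp_all add: mem_box_cart)
      then show "2 powi k * of_int (m i) + grid_shift (\<beta> i) k \<le> x $ i \<and> x $ i < 2 powi k * (of_int (m i) + 1) + grid_shift (\<beta> i) k"
        using bm[of i] by linarith
    qed
  qed
  then have "I \<subseteq> J" using I(2) by blast
  moreover have "J \<in> shifted_grid \<beta>" unfolding J_def shifted_grid_def by blast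
  moreover have "is_cube J" unfolding J_def grid_cube_def by (rule is_cube_half_open_cube) simp
  moreover have "measure lebesgue J \<le> 6 ^ CARD('d) * measure lebesgue I"
  proof -
    have "measure lebesgue J = (2 powi k) ^ CARD('d)"
      unfolding J_def grid_cube_def measure_def
      by (subst between_boxes_lebesgue(2)[OF _ half_open_cube_between_boxes]) auto
    also have "\<dots> \<le> (6 * l) ^ CARD('d)" using k by (intro power_mono) auto
    also have "\<dots> = 6 ^ CARD('d) * measure lebesgue I"
      unfolding measure_def between_boxes_lebesgue(2)[OF l I] using l by (simp add: power_mult_distrib)
    finally show ?thesis .
  qed
  ultimately show thesis using that by blast
qed

section \<open>Weighted BMO over the shifted grids\<close>

text \<open>The sum of the finitely many suprema is a common bound for the oscillation over all grid
  cubes; together with \<open>c\<close> it determines the bound for the cubes inside them.\<close>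

lemma (in dual_weights) finite_oscillation_from_grids:
  fixes F :: "real^'d \<Rightarrow> complex^'n^'n" and D :: "'t \<Rightarrow> (real^'d) set set"
  defines "osc \<equiv> \<lambda>I. nn_avg I (\<lambda>x. ennreal
      (op_norm (P x ** (F x - mat_avg I F) ** matrix_inv (A I)) powr q))"
  assumes F: "locally_integrable F" and T: "finite T"
    and cover: "\<And>I. is_cube I \<Longrightarrow> \<exists>t\<in>T. \<exists>J\<in>D t. I \<subseteq> J \<and> is_cube J \<and>
      measure lebesgue J \<le> c * measure lebesgue I" and c0: "0 \<le> c"
    and fin: "\<And>t. t \<in> T \<Longrightarrow> (SUP J\<in>D t. osc J) < top"
  shows "(SUP I\<in>{I. is_cube I}. osc I) < top"
proof -
  let ?n = "real CARD('n)"
  have q0: "0 \<le> q" using exponents by simp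
  have [measurable]: "F \<in> borel_measurable lebesgue" by (rule locally_integrable_measurable[OF F])
  define b where "b = enn2real (\<Sum>t\<in>T. SUP J\<in>D t. osc J)"
  have b: "ennreal b = (\<Sum>t\<in>T. SUP J\<in>D t. osc J)" "0 \<le> b"
    unfolding b_def using T fin by simp_all
  have Jb: "oscillation J F \<le> ennreal (?n powr q * b)" if "t \<in> T" "J \<in> D t" "is_cube J" for t J
  proof -
    have "oscillation J F \<le> ennreal (?n powr q) * osc J"
      unfolding osc_def
    proof (rule nn_avg_le_cmult[OF \<open>is_cube J\<close>])
      have "norm X powr q \<le> ?n powr q * op_norm X powr q" for X :: "complex^'n^'n"
        using powr_mono2[OF q0 _ norm_le_op_norm[of X]] by (simp add: powr_mult op_norm_nonneg)
      then show "AE x in lebesgue. x \<in> J \<longrightarrow>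
          ennreal (norm (P x ** (F x - mat_avg J F) ** matrix_inv (A J)) powr q) \<le>
          ennreal (?n powr q) * ennreal (op_norm (P x ** (F x - mat_avg J F) ** matrix_inv (A J)) powr q)"
        by (simp add: ennreal_leI flip: ennreal_mult')
    qed simp_all
    also have "osc J \<le> (SUP J\<in>D t. osc J)" by (rule SUP_upper[OF \<open>J \<in> D t\<close>])
    also have "\<dots> \<le> ennreal b"
      unfolding b by (rule member_le_sum[OF \<open>t \<in> T\<close> _ T]) simp
    finally show ?thesis using b by (simp add: ennreal_mult mult_left_mono)
  qed
  have "0 \<le> ?n powr q * b" using b by simp
  then obtain B where B: "\<And>I J F. is_cube I \<Longrightarrow> is_cube J \<Longrightarrow> I \<subseteq> J \<Longrightarrow>
      measure lebesgue J \<le> c * measure lebesgue I \<Longrightarrow> locally_integrable F \<Longrightarrow>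
      oscillation J F \<le> ennreal (?n powr q * b) \<Longrightarrow> oscillation I F \<le> ennreal B"
    using oscillation_subcube[OF c0] by blast
  have "osc I \<le> ennreal B" if I: "is_cube I" for I
  proof -
    obtain t J where t: "t \<in> T" "J \<in> D t" and J: "I \<subseteq> J" "is_cube J"
      and JI: "measure lebesgue J \<le> c * measure lebesgue I"
      using cover[OF I] by blast
    have "osc I \<le> oscillation I F"
      unfolding osc_def
      by (intro nn_avg_mono AE_I2 impI ennreal_leI powr_mono2 q0 op_norm_nonneg op_norm_le_norm)
    also have "\<dots> \<le> ennreal B"
      by (rule B[OF I J(2,1) JI F Jb[OF t J(2)]])
    finally show ?thesis .
  qed
  then have "(SUP I\<in>{I. is_cube I}. osc I) \<le> ennreal B" by (intro SUP_least) auto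
  then show ?thesis by (rule le_less_trans) simp
qed

text \<open>The statement is symmetric under the exchange of \<open>(q, s, A)\<close> and \<open>(q', - s, A')\<close>; the two
  instances belong to the two BMO conditions.\<close>

lemma dual_weights_of_reducing_ops:
  fixes W :: "real^'d \<Rightarrow> complex^'n^'n"
  assumes W: "W \<in> borel_measurable lebesgue" "AE x in lebesgue. pos_def (W x)"
    and exps: "1 < q" "1 < q'" "1 / q + 1 / q' = 1"
    and A: "\<And>I. is_cube I \<Longrightarrow> reducing_op q s W I (A I)"
    and A': "\<And>I. is_cube I \<Longrightarrow> reducing_op q' (- s) W I (A' I)"
    and C: "0 \<le> C" "\<And>I. is_cube I \<Longrightarrow> norm (A I ** A' I) \<le> C"
  obtains K where "dual_weights (\<lambda>x. mat_powr (W x) s) (\<lambda>x. mat_powr (W x) (- s)) q q' K C A A'"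
proof -
  let ?n = "real CARD('n)"
  define c where "c = reducing_const ?n q' * norm (mat 1 :: complex^'n^'n) powr q'"
  define K where "K = reducing_const ?n q + c"
  have c: "0 \<le> c" "0 < reducing_const ?n q"
    using reducing_const_pos[of ?n] by (simp_all add: c_def less_imp_le)
  have pd: "pos_def (A I)" "pos_def (A' I)" if "is_cube I" for I
    using A A' that unfolding reducing_op_def by blast+
  have "dual_weights (\<lambda>x. mat_powr (W x) s) (\<lambda>x. mat_powr (W x) (- s)) q q' K C A A'"
  proof
    show "(\<lambda>x. mat_powr (W x) s) \<in> borel_measurable lebesgue"
      and Q: "(\<lambda>x. mat_powr (W x) (- s)) \<in> borel_measurable lebesgue"
      by (intro measurable_mat_powr W)+
    show "AE x in lebesgue. mat_powr (W x) (- s) ** mat_powr (W x) s = mat 1"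
      using W(2) by eventually_elim (use mat_powr_mult_minus[of _ "- s"] in simp)
    show "1 < q" "1 < q'" "1 / q + 1 / q' = 1" "0 \<le> C" by fact+
    show "0 < K" using c by (simp add: K_def)
    fix I :: "(real^'d) set" assume I: "is_cube I"
    show "A I ** matrix_inv (A I) = mat 1" "matrix_inv (A I) ** A I = mat 1"
      and inv': "A' I ** matrix_inv (A' I) = mat 1"
      using matrix_inv_pos_def pd[OF I] by blast+
    show "norm (A I ** A' I) \<le> C" by (rule C(2)[OF I])
    show "nn_avg I (\<lambda>x. ennreal (norm (mat_powr (W x) s ** X) powr q)) \<le> ennreal (K * norm (A I ** X) powr q)"
      for X :: "complex^'n^'n"
    proof -
      have "nn_avg I (\<lambda>x. ennreal (norm (mat_powr (W x) s ** X) powr q)) \<le>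
          ennreal (reducing_const ?n q * norm (A I ** X) powr q)"
        by (rule reducing_op_matrix(1)[OF A[OF I] _ I]) (use exps in \<open>auto intro: measurable_mat_powr W\<close>)
      also have "\<dots> \<le> ennreal (K * norm (A I ** X) powr q)"
        unfolding K_def using c by (intro ennreal_leI mult_right_mono) auto
      finally show ?thesis .
    qed
    have inv_herm: "conj_transpose (matrix_inv (A' I)) = matrix_inv (A' I)"
    proof -
      have "conj_transpose (matrix_inv (A' I)) ** A' I = mat 1"
        using arg_cong[OF inv', of conj_transpose] pd(2)[OF I]
        by (simp add: conj_transpose_mult pos_def_def)
      then show ?thesis using inv' by (metis matrix_mul_assoc matrix_mul_lid matrix_mul_rid)
    qed
    have "nn_avg I (\<lambda>x. ennreal (norm (matrix_inv (A' I) ** mat_powr (W x) (- s)) powr q')) \<le>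
        nn_avg I (\<lambda>x. ennreal (norm (mat_powr (W x) (- s) ** matrix_inv (A' I)) powr q'))"
    proof (rule nn_avg_mono, use W(2) in eventually_elim, intro impI)
      fix x assume "pos_def (W x)"
      then have "norm (matrix_inv (A' I) ** mat_powr (W x) (- s)) = norm (mat_powr (W x) (- s) ** matrix_inv (A' I))"
        using norm_conj_transpose[of "matrix_inv (A' I) ** mat_powr (W x) (- s)"] inv_herm
        by (simp only: conj_transpose_mult conj_transpose_mat_powr)
      then show "ennreal (norm (matrix_inv (A' I) ** mat_powr (W x) (- s)) powr q') \<le>
          ennreal (norm (mat_powr (W x) (- s) ** matrix_inv (A' I)) powr q')" by simp
    qed
    also have "\<dots> \<le> ennreal c"
      unfolding c_def inv'[symmetric]
      by (rule reducing_op_matrix(1)[OF A'[OF I] _ I Q]) (use exps in simp)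
    also have "\<dots> \<le> ennreal K"
      using c by (intro ennreal_leI) (simp add: K_def)
    finally show "nn_avg I (\<lambda>x. ennreal (norm (matrix_inv (A' I) ** mat_powr (W x) (- s)) powr q')) \<le> ennreal K" .
  qed
  then show thesis by (rule that)
qed

lemma locally_integrable_conj_transpose:
  fixes B :: "real^'d \<Rightarrow> complex^'n^'n"
  assumes "locally_integrable B"
  shows "locally_integrable (\<lambda>x. conj_transpose (B x))"
  unfolding locally_integrable_def set_integrable_def
proof (intro allI impI)
  fix K :: "(real^'d) set" assume "compact K"
  then have "integrable lebesgue (\<lambda>x. conj_transpose (indicator K x *\<^sub>R B x))"
    using assms unfolding locally_integrable_def set_integrable_def
    by (intro integrable_bounded_linear[OF bounded_linear_conj_transpose]) auto
  then show "integrable lebesgue (\<lambda>x. indicator K x *\<^sub>R conj_transpose (B x))"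
    by (simp add: linear_cmul[OF bounded_linear.linear[OF bounded_linear_conj_transpose]])
qed

theorem proposition1p4:
  fixes W :: "real^'d \<Rightarrow> complex^'n^'n" and p :: real
  assumes "1 < p" and "Ap_weight p W"
  shows "\<exists>D :: nat \<Rightarrow> (real^'d) set set.
    (\<forall>t\<in>{1..2 ^ CARD('d)}. dyadic_grid (D t)) \<and>
    (\<forall>c V V'. reducing_families p W V V' \<longrightarrow>
       BMO c p W V V' {I. is_cube I} = (\<Inter>t\<in>{1..2 ^ CARD('d)}. BMO c p W V V' (D t)))"
proof -
  let ?T = "{1..2 ^ CARD('d)} :: nat set"
  have "card (UNIV :: ('d \<Rightarrow> bool) set) = 2 ^ CARD('d)" by (simp add: card_fun)
  then obtain h where h: "bij_betw h ?T (UNIV :: ('d \<Rightarrow> bool) set)"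
    using ex_bij_betw_nat_finite_1[of "UNIV :: ('d \<Rightarrow> bool) set"] by auto
  define D :: "nat \<Rightarrow> (real^'d) set set" where "D t = shifted_grid (h t)" for t
  have cover: "\<exists>t\<in>?T. \<exists>J\<in>D t. I \<subseteq> J \<and> is_cube J \<and> measure lebesgue J \<le> 6 ^ CARD('d) * measure lebesgue I"
    if I: "is_cube I" for I
  proof -
    obtain \<beta> J where J: "J \<in> shifted_grid \<beta>" "I \<subseteq> J" "is_cube J"
      "measure lebesgue J \<le> 6 ^ CARD('d) * measure lebesgue I"
      using cube_in_shifted_grid[OF I] by metis
    moreover obtain t where "t \<in> ?T" "h t = \<beta>"
      using h unfolding bij_betw_def by (metis UNIV_I imageE)
    ultimately show ?thesis unfolding D_def by blast
  qed
  have D_cube: "D t \<subseteq> {I. is_cube I}" for t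
    unfolding D_def shifted_grid_def grid_cube_def by (auto intro: is_cube_half_open_cube)
  define q where "q = conj_exp p"
  have exps: "1 < p" "1 < q" "1 / p + 1 / q = 1" "1 / q + 1 / p = 1"
    using assms(1) by (auto simp: q_def conj_exp_def field_simps)
  have W: "W \<in> borel_measurable lebesgue" "AE x in lebesgue. pos_def (W x)"
    using assms(2) by (auto simp: Ap_weight_def)
  have "BMO c p W V V' {I. is_cube I} = (\<Inter>t\<in>?T. BMO c p W V V' (D t))"
    if red: "reducing_families p W V V'" for c V V'
  proof -
    have minus: "-1 / p = - (1 / p)" by simp
    have V: "reducing_op p (1 / p) W I (V I)" and V': "reducing_op q (- (1 / p)) W I (V' I)"
      if "is_cube I" for I
      using red that unfolding reducing_families_def q_def minus by blast+
    obtain C where C: "0 \<le> C" "\<And>I. is_cube I \<Longrightarrow> norm (V I ** V' I) \<le> C"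
      using Ap_reducing_bound[OF assms] V V' unfolding q_def by metis
    have C': "norm (V' I ** V I) \<le> C" if "is_cube I" for I
      using C(2)[OF that] norm_conj_transpose[of "V I ** V' I"] V[OF that] V'[OF that]
      by (simp add: conj_transpose_mult reducing_op_def pos_def_def)
    obtain K where K: "dual_weights (\<lambda>x. mat_powr (W x) (1 / p)) (\<lambda>x. mat_powr (W x) (- (1 / p))) p q K C V V'"
      using dual_weights_of_reducing_ops[OF W exps(1,2,3) V V' C] by blast
    have Vm: "reducing_op p (- (- (1 / p))) W I (V I)" if "is_cube I" for I
      using V[OF that] by simp
    obtain K' where K': "dual_weights (\<lambda>x. mat_powr (W x) (- (1 / p))) (\<lambda>x. mat_powr (W x) (- (- (1 / p)))) q p K' C V' V"
      using dual_weights_of_reducing_ops[OF W exps(2,1,4) V' Vm C(1) C'] by blast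
    have primal: "bmo_sup p W V {I. is_cube I} B < top"
      if "locally_integrable B" "\<And>t. t \<in> ?T \<Longrightarrow> bmo_sup p W V (D t) B < top" for B
      using dual_weights.finite_oscillation_from_grids[OF K that(1), of ?T D "6 ^ CARD('d)"] cover that(2)
      unfolding bmo_sup_def by simp
    have dual: "bmo_sup_dual p W V' {I. is_cube I} B < top"
      if "locally_integrable B" "\<And>t. t \<in> ?T \<Longrightarrow> bmo_sup_dual p W V' (D t) B < top" for B
      using dual_weights.finite_oscillation_from_grids
          [OF K' locally_integrable_conj_transpose[OF that(1)], of ?T D "6 ^ CARD('d)"] cover that(2)
      unfolding bmo_sup_dual_def q_def minus by simp
    have mono: "bmo_sup p W V (D t) B \<le> bmo_sup p W V {I. is_cube I} B"
      "bmo_sup_dual p W V' (D t) B \<le> bmo_sup_dual p W V' {I. is_cube I} B" for t B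
      unfolding bmo_sup_def bmo_sup_dual_def by (intro SUP_subset_mono D_cube order_refl)+
    have T: "(1::nat) \<in> ?T" by simp
    show ?thesis
    proof (intro equalityI subsetI INT_I)
      fix B t assume "B \<in> BMO c p W V V' {I. is_cube I}"
      then show "B \<in> BMO c p W V V' (D t)"
        unfolding BMO_def using mono[of t B] by (auto intro: le_less_trans)
    next
      fix B assume B: "B \<in> (\<Inter>t\<in>?T. BMO c p W V V' (D t))"
      then have "locally_integrable B" using T unfolding BMO_def by blast
      then show "B \<in> BMO c p W V V' {I. is_cube I}"
        using B primal[of B] dual[of B] unfolding BMO_def by auto
    qed
  qed
  moreover have "dyadic_grid (D t)" for t
    unfolding D_def by (rule dyadic_grid_shifted_grid)
  ultimately show ?thesis by blast
qed

end
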